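(* Let $(E,\|\cdot\|)$ be a random normed module over $K$ with base $(\Omega,\mathcal{F},P)$ having full support, and let $E^{*}(1)=\{f\in E^{*}:\|f\|^*\le1\}$. If $E^{*}(1)$ is $\sigma_{c}(E^{*},E)$-compact, then $\mathcal{F}$ is essentially purely $P$-atomic. But the converse is not true: there exist a probability space $(\Omega,\mathcal F,P)$ with $\mathcal F$ essentially purely $P$-atomic and a random normed module $(E,\|\cdot\|)$ with base $(\Omega,\mathcal F,P)$ and full support such that $E^*(1)$ is not $\sigma_c(E^*,E)$-compact.
   Context: $(\Omega,\mathcal{F},P)$ is a probability space, $K=\mathbb{R}$ or $\mathbb{C}$, and $L^{0}(\mathcal{F},K)$ is the algebra of equivalence classes (under a.s. equality) of $K$-valued $\mathcal{F}$-measurable functions; $L^0(\mathcal F,\bar{\mathbb R})$ (extended real-valued functions) is a complete lattice under a.s. pointwise order, with $\vee,\wedge$ supremum and infimum. $L^0_+=\{\xi\in L^0(\mathcal F,\mathbb R):\xi\ge 0\}$; $L^0_{++}$ is the set of $\xi\in L^0_+$ with $\xi>0$ a.s. on $\Omega$. A random normed module over $K$ with base $(\Omega,\mathcal F,P)$ is a left $L^0(\mathcal F,K)$-module $E$ with an $L^0$-norm $\|\cdot\|:E\to L^0_+$, i.e. $\|\xi x\|=|\xi|\|x\|$, $\|x+y\|\le\|x\|+\|y\|$, and $\|x\|=0$ iff $x=\theta$. Its random conjugate space $E^*$ is the $L^0(\mathcal F,K)$-module of module homomorphisms $f:E\to L^0(\mathcal F,K)$ for which there is $\xi\in L^0_+$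 with $|f(x)|\le\xi\|x\|$ for all $x\in E$ (equivalently, the continuous ones, for either the $(\varepsilon,\lambda)$- or the locally $L^0$-convex topology), with $\|f\|^*=\wedge\{\xi\in L^0_+:|f(x)|\le\xi\|x\|\ \forall x\in E\}$. $E$ has full support if a representative $\xi^0$ of $\xi=\vee\{\|x\|:x\in E\}$ satisfies $\xi^0(\omega)>0$ for almost all $\omega\in\Omega$. $\sigma_c(E^*,E)$ is the topology on $E^*$ in which $G\subset E^*$ is open iff for every $f\in G$ there are finitely many $x_1,\dots,x_k\in E$ and $\varepsilon\in L^0_{++}$ such that $\{g\in E^*:|g(x_i)-f(x_i)|\le\varepsilon,\ i=1,\dots,k\}\subset G$. $A\in\mathcal F$ is a $P$-atom if $P(A)>0$ and every $B\in\mathcal F$ with $B\subset A$ satisfies $P(B)=0$ or $P(A\setminus B)=0$. $\mathcal F$ (or $(\Omega,\mathcal F,P)$) is essentially purely $P$-atomic if there is a (finite or infinite) sequence $\{A_n\}$ of disjoint $P$-atoms with $\bigcup_nA_n=\Omega$ such that $\mathcal F$ is contained in the $P$-completion of the $\sigma$-algebra generated by $\{A_n\}$. *)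

theory Defs
  imports "HOL-Probability.Probability_Measure" "HOL-Algebra.Module" "HOL-Algebra.Lattice"
begin

section \<open>The algebra of random variables modulo almost sure equality\<close>

definition L0_class ::
  "'w measure \<Rightarrow> ('w \<Rightarrow> 'b::topological_space) \<Rightarrow> ('w \<Rightarrow> 'b) set" where
  "L0_class M f = {g \<in> borel_measurable M. AE w in M. g w = f w}"

definition L0 :: "'w measure \<Rightarrow> ('w \<Rightarrow> 'b::topological_space) set set" where
  "L0 M = L0_class M ` borel_measurable M"

text \<open>An arbitrarily chosen representative; nothing below depends on the choice.\<close>

definition L0_rep :: "('w \<Rightarrow> 'b) set \<Rightarrow> 'w \<Rightarrow> 'b" where
  "L0_rep X = (SOME f. f \<in> X)"

definition L0_ring :: "'w measure \<Rightarrow> ('w \<Rightarrow> 'k::real_normed_field) set ring" where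
  "L0_ring M =
    \<lparr>carrier = L0 M,
     monoid.mult = (\<lambda>X Y. L0_class M (\<lambda>w. L0_rep X w * L0_rep Y w)),
     one = L0_class M (\<lambda>w. 1),
     ring.zero = L0_class M (\<lambda>w. 0),
     add = (\<lambda>X Y. L0_class M (\<lambda>w. L0_rep X w + L0_rep Y w))\<rparr>"

definition L0_abs :: "'w measure \<Rightarrow> ('w \<Rightarrow> 'k::real_normed_field) set \<Rightarrow> ('w \<Rightarrow> real) set" where
  "L0_abs M X = L0_class M (\<lambda>w. norm (L0_rep X w))"

definition L0_le :: "'w measure \<Rightarrow> ('w \<Rightarrow> 'b::ord) set \<Rightarrow> ('w \<Rightarrow> 'b) set \<Rightarrow> bool" where
  "L0_le M X Y \<longleftrightarrow> (AE w in M. L0_rep X w \<le> L0_rep Y w)"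

definition L0_plus :: "'w measure \<Rightarrow> ('w \<Rightarrow> real) set set" where
  "L0_plus M = {X \<in> L0 M. L0_le M (L0_class M (\<lambda>w. 0)) X}"

definition L0_pos :: "'w measure \<Rightarrow> ('w \<Rightarrow> real) set set" where
  "L0_pos M = {X \<in> L0_plus M. AE w in M. 0 < L0_rep X w}"

text \<open>Suprema and infima are those of the complete lattice of extended real random variables,
  into which the real ones are embedded.\<close>

definition L0_ereal_lattice :: "'w measure \<Rightarrow> ('w \<Rightarrow> ereal) set gorder" where
  "L0_ereal_lattice M = \<lparr>carrier = L0 M, eq = (=), le = L0_le M\<rparr>"

definition L0_ereal :: "'w measure \<Rightarrow> ('w \<Rightarrow> real) set \<Rightarrow> ('w \<Rightarrow> ereal) set" where
  "L0_ereal M X = L0_class M (\<lambda>w. ereal (L0_rep X w))"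


section \<open>Random normed modules\<close>

locale random_normed_module =
  prob_space M + E?: Module.module "L0_ring M" E
  for M :: "'w measure"
    and E :: "(('w \<Rightarrow> 'k::real_normed_field) set, 'e, 'm) module_scheme" (structure) +
  fixes nrm :: "'e \<Rightarrow> ('w \<Rightarrow> real) set"
  assumes nrm_in_L0_plus: "x \<in> carrier E \<Longrightarrow> nrm x \<in> L0_plus M"
    and nrm_smult: "\<xi> \<in> L0 M \<Longrightarrow> x \<in> carrier E \<Longrightarrow>
      nrm (\<xi> \<odot>\<^bsub>E\<^esub> x) = L0_abs M \<xi> \<otimes>\<^bsub>L0_ring M\<^esub> nrm x"
    and nrm_triangle: "x \<in> carrier E \<Longrightarrow> y \<in> carrier E \<Longrightarrow>
      L0_le M (nrm (x \<oplus>\<^bsub>E\<^esub> y)) (nrm x \<oplus>\<^bsub>L0_ring M\<^esub> nrm y)"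
    and nrm_eq_zero_iff: "x \<in> carrier E \<Longrightarrow> nrm x = \<zero>\<^bsub>L0_ring M\<^esub> \<longleftrightarrow> x = \<zero>\<^bsub>E\<^esub>"

definition full_support ::
  "'w measure \<Rightarrow> (('w \<Rightarrow> 'k::real_normed_field) set, 'e, 'm) module_scheme
    \<Rightarrow> ('e \<Rightarrow> ('w \<Rightarrow> real) set) \<Rightarrow> bool" where
  "full_support M E nrm \<longleftrightarrow>
    (AE w in M. 0 < L0_rep (\<Squnion>\<^bsub>L0_ereal_lattice M\<^esub> ((\<lambda>x. L0_ereal M (nrm x)) ` carrier E)) w)"

definition dual_bounds ::
  "'w measure \<Rightarrow> (('w \<Rightarrow> 'k::real_normed_field) set, 'e, 'm) module_scheme
    \<Rightarrow> ('e \<Rightarrow> ('w \<Rightarrow> real) set) \<Rightarrow> ('e \<Rightarrow> ('w \<Rightarrow> 'k) set) \<Rightarrow> ('w \<Rightarrow> real) set set" where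
  "dual_bounds M E nrm f =
    {\<xi> \<in> L0_plus M. \<forall>x\<in>carrier E. L0_le M (L0_abs M (f x)) (\<xi> \<otimes>\<^bsub>L0_ring M\<^esub> nrm x)}"

definition random_dual ::
  "'w measure \<Rightarrow> (('w \<Rightarrow> 'k::real_normed_field) set, 'e, 'm) module_scheme
    \<Rightarrow> ('e \<Rightarrow> ('w \<Rightarrow> real) set) \<Rightarrow> ('e \<Rightarrow> ('w \<Rightarrow> 'k) set) set" where
  "random_dual M E nrm =
    {f \<in> carrier E \<rightarrow>\<^sub>E L0 M.
      (\<forall>x\<in>carrier E. \<forall>y\<in>carrier E. f (x \<oplus>\<^bsub>E\<^esub> y) = f x \<oplus>\<^bsub>L0_ring M\<^esub> f y) \<and>
      (\<forall>\<xi>\<in>L0 M. \<forall>x\<in>carrier E. f (\<xi> \<odot>\<^bsub>E\<^esub> x) = \<xi> \<otimes>\<^bsub>L0_ring M\<^esub> f x) \<and>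
      dual_bounds M E nrm f \<noteq> {}}"

definition dual_norm ::
  "'w measure \<Rightarrow> (('w \<Rightarrow> 'k::real_normed_field) set, 'e, 'm) module_scheme
    \<Rightarrow> ('e \<Rightarrow> ('w \<Rightarrow> real) set) \<Rightarrow> ('e \<Rightarrow> ('w \<Rightarrow> 'k) set) \<Rightarrow> ('w \<Rightarrow> ereal) set" where
  "dual_norm M E nrm f = \<Sqinter>\<^bsub>L0_ereal_lattice M\<^esub> (L0_ereal M ` dual_bounds M E nrm f)"

definition dual_unit_ball ::
  "'w measure \<Rightarrow> (('w \<Rightarrow> 'k::real_normed_field) set, 'e, 'm) module_scheme
    \<Rightarrow> ('e \<Rightarrow> ('w \<Rightarrow> real) set) \<Rightarrow> ('e \<Rightarrow> ('w \<Rightarrow> 'k) set) set" where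
  "dual_unit_ball M E nrm =
    {f \<in> random_dual M E nrm. L0_le M (dual_norm M E nrm f) (L0_class M (\<lambda>w. 1))}"


section \<open>The locally \<open>L\<^sup>0\<close>-convex weak-star topology\<close>

definition sigma_c_nbhd ::
  "'w measure \<Rightarrow> (('w \<Rightarrow> 'k::real_normed_field) set, 'e, 'm) module_scheme
    \<Rightarrow> ('e \<Rightarrow> ('w \<Rightarrow> real) set) \<Rightarrow> ('e \<Rightarrow> ('w \<Rightarrow> 'k) set) \<Rightarrow> 'e set \<Rightarrow> ('w \<Rightarrow> real) set
    \<Rightarrow> ('e \<Rightarrow> ('w \<Rightarrow> 'k) set) set" where
  "sigma_c_nbhd M E nrm f X \<epsilon> =
    {g \<in> random_dual M E nrm. \<forall>x\<in>X. L0_le M (L0_abs M (g x \<ominus>\<^bsub>L0_ring M\<^esub> f x)) \<epsilon>}"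

definition sigma_c_open ::
  "'w measure \<Rightarrow> (('w \<Rightarrow> 'k::real_normed_field) set, 'e, 'm) module_scheme
    \<Rightarrow> ('e \<Rightarrow> ('w \<Rightarrow> real) set) \<Rightarrow> ('e \<Rightarrow> ('w \<Rightarrow> 'k) set) set \<Rightarrow> bool" where
  "sigma_c_open M E nrm G \<longleftrightarrow>
    G \<subseteq> random_dual M E nrm \<and>
    (\<forall>f\<in>G. \<exists>X \<epsilon>. finite X \<and> X \<subseteq> carrier E \<and> \<epsilon> \<in> L0_pos M \<and> sigma_c_nbhd M E nrm f X \<epsilon> \<subseteq> G)"

definition sigma_c ::
  "'w measure \<Rightarrow> (('w \<Rightarrow> 'k::real_normed_field) set, 'e, 'm) module_scheme
    \<Rightarrow> ('e \<Rightarrow> ('w \<Rightarrow> real) set) \<Rightarrow> ('e \<Rightarrow> ('w \<Rightarrow> 'k) set) topology" where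
  "sigma_c M E nrm = topology (sigma_c_open M E nrm)"


section \<open>Essentially purely atomic probability spaces\<close>

definition P_atom :: "'w measure \<Rightarrow> 'w set \<Rightarrow> bool" where
  "P_atom M A \<longleftrightarrow> A \<in> sets M \<and> measure M A > 0 \<and>
    (\<forall>B\<in>sets M. B \<subseteq> A \<longrightarrow> measure M B = 0 \<or> measure M (A - B) = 0)"

text \<open>The completion of a sub-\<open>\<sigma>\<close>-algebra adjoins all subsets of null sets of the whole
  space \<open>M\<close>, as \<^term>\<open>null_sets (completion M)\<close> does. Completing the restriction of the
  measure to the \<open>\<sigma>\<close>-algebra generated by a countable partition into sets of positive measure
  would adjoin nothing, so that nonempty null sets would be excluded.\<close>

definition P_completion :: "'w measure \<Rightarrow> 'w set set \<Rightarrow> 'w set set" where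
  "P_completion M \<G> = sigma_sets (space M) (\<G> \<union> null_sets (completion M))"

text \<open>A sequence of disjoint atoms has no repetitions, so it amounts to a countable set.\<close>

definition essentially_purely_atomic :: "'w measure \<Rightarrow> bool" where
  "essentially_purely_atomic M \<longleftrightarrow>
    (\<exists>\<A>. countable \<A> \<and> disjoint \<A> \<and> (\<forall>A\<in>\<A>. P_atom M A) \<and> \<Union>\<A> = space M \<and>
      sets M \<subseteq> P_completion M (sigma_sets (space M) \<A>))"


section \<open>Well-definedness\<close>

lemma L0_class_self: "f \<in> borel_measurable M \<Longrightarrow> f \<in> L0_class M f"
  by (simp add: L0_class_def)

lemma L0_class_eqI: "AE w in M. f w = g w \<Longrightarrow> L0_class M f = L0_class M g"
  unfolding L0_class_def by (auto elim: eventually_elim2)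

lemma L0_rep_class:
  assumes "f \<in> borel_measurable M"
  shows "L0_rep (L0_class M f) \<in> borel_measurable M" "AE w in M. L0_rep (L0_class M f) w = f w"
proof -
  have "L0_rep (L0_class M f) \<in> L0_class M f"
    unfolding L0_rep_def by (rule someI[where P = "\<lambda>g. g \<in> L0_class M f"]) (rule L0_class_self[OF assms])
  then show "L0_rep (L0_class M f) \<in> borel_measurable M"
    "AE w in M. L0_rep (L0_class M f) w = f w"
    by (auto simp: L0_class_def)
qed

lemma L0_rep_L0:
  assumes "X \<in> L0 M"
  shows "L0_rep X \<in> borel_measurable M" "L0_class M (L0_rep X) = X"
  using assms L0_rep_class unfolding L0_def by (auto intro!: L0_class_eqI)

lemma L0_class_in: "f \<in> borel_measurable M \<Longrightarrow> L0_class M f \<in> L0 M"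
  by (simp add: L0_def)

lemma cring_L0_ring:
  "cring (L0_ring M :: ('w \<Rightarrow> 'k::{real_normed_field, second_countable_topology}) set ring)"
  (is "cring ?R")
proof -
  have add: "L0_class M f \<oplus>\<^bsub>?R\<^esub> L0_class M g = L0_class M (\<lambda>w. f w + g w)"
    and mult: "L0_class M f \<otimes>\<^bsub>?R\<^esub> L0_class M g = L0_class M (\<lambda>w. f w * g w)"
    if "f \<in> borel_measurable M" "g \<in> borel_measurable M" for f g :: "'w \<Rightarrow> 'k"
    using L0_rep_class(2)[OF that(1)] L0_rep_class(2)[OF that(2)]
    by (auto simp: L0_ring_def intro!: L0_class_eqI)
  have car: "carrier ?R = L0_class M ` borel_measurable M"
    and zero: "\<zero>\<^bsub>?R\<^esub> = L0_class M (\<lambda>w. 0)" and one: "\<one>\<^bsub>?R\<^esub> = L0_class M (\<lambda>w. 1)"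
    by (simp_all add: L0_ring_def L0_def)
  have "abelian_group ?R"
  proof (rule abelian_groupI)
    fix X assume "X \<in> carrier ?R"
    then obtain f where f: "f \<in> borel_measurable M" "X = L0_class M f" by (auto simp: car)
    then have "L0_class M (\<lambda>w. - f w) \<oplus>\<^bsub>?R\<^esub> X = \<zero>\<^bsub>?R\<^esub>"
      by (simp add: add zero)
    moreover have "L0_class M (\<lambda>w. - f w) \<in> carrier ?R" using f by (simp add: car)
    ultimately show "\<exists>Y\<in>carrier ?R. Y \<oplus>\<^bsub>?R\<^esub> X = \<zero>\<^bsub>?R\<^esub>" by blast
  qed (auto simp: car add zero ac_simps)
  moreover have "Group.comm_monoid ?R"
    by (rule comm_monoidI) (auto simp: car mult one ac_simps)
  ultimately show ?thesis
    by (rule cringI) (auto simp: car add mult algebra_simps)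
qed

lemma istopology_sigma_c_open: "istopology (sigma_c_open M E nrm)"
  unfolding istopology_def
proof (intro conjI allI impI)
  fix S T assume ST: "sigma_c_open M E nrm S" "sigma_c_open M E nrm T"
  show "sigma_c_open M E nrm (S \<inter> T)"
    unfolding sigma_c_open_def
  proof (intro conjI ballI)
    show "S \<inter> T \<subseteq> random_dual M E nrm" using ST by (auto simp: sigma_c_open_def)
    fix f assume "f \<in> S \<inter> T"
    then obtain X \<epsilon> Y \<delta> where
      X: "finite X" "X \<subseteq> carrier E" "\<epsilon> \<in> L0_pos M" "sigma_c_nbhd M E nrm f X \<epsilon> \<subseteq> S" and
      Y: "finite Y" "Y \<subseteq> carrier E" "\<delta> \<in> L0_pos M" "sigma_c_nbhd M E nrm f Y \<delta> \<subseteq> T"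
      using ST unfolding sigma_c_open_def by (metis IntD1 IntD2)
    define m where "m w = min (L0_rep \<epsilon> w) (L0_rep \<delta> w)" for w
    define \<mu> where "\<mu> = L0_class M m"
    have meas: "m \<in> borel_measurable M"
      using X(3) Y(3) L0_rep_L0(1) unfolding m_def L0_pos_def L0_plus_def
      by (auto intro!: borel_measurable_min)
    have rep: "AE w in M. L0_rep \<mu> w = m w"
      unfolding \<mu>_def by (rule L0_rep_class(2)[OF meas])
    have zero: "AE w in M. L0_rep (L0_class M (\<lambda>w. 0)) w = (0::real)"
      by (rule L0_rep_class(2)) simp
    have eps: "AE w in M. 0 < L0_rep \<epsilon> w" and del: "AE w in M. 0 < L0_rep \<delta> w"
      using X(3) Y(3) by (auto simp: L0_pos_def)
    have pos: "AE w in M. 0 < L0_rep \<mu> w"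
      using rep eps del by eventually_elim (simp add: m_def)
    have "\<mu> \<in> L0_plus M"
      unfolding L0_plus_def L0_le_def
    proof (intro CollectI conjI)
      show "\<mu> \<in> L0 M" unfolding \<mu>_def by (rule L0_class_in[OF meas])
      show "AE w in M. L0_rep (L0_class M (\<lambda>w. 0)) w \<le> L0_rep \<mu> w"
        using zero pos by eventually_elim simp
    qed
    then have "\<mu> \<in> L0_pos M" using pos by (simp add: L0_pos_def)
    moreover have "L0_le M Z \<epsilon>" "L0_le M Z \<delta>" if "L0_le M Z \<mu>" for Z
    proof -
      have Z: "AE w in M. L0_rep Z w \<le> L0_rep \<mu> w" using that by (simp add: L0_le_def)
      show "L0_le M Z \<epsilon>" unfolding L0_le_def using Z rep by eventually_elim (simp add: m_def)
      show "L0_le M Z \<delta>" unfolding L0_le_def using Z rep by eventually_elim (simp add: m_def)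
    qed
    then have "sigma_c_nbhd M E nrm f (X \<union> Y) \<mu> \<subseteq> S \<inter> T"
      using X(4) Y(4) unfolding sigma_c_nbhd_def by blast
    ultimately show "\<exists>X \<epsilon>. finite X \<and> X \<subseteq> carrier E \<and> \<epsilon> \<in> L0_pos M \<and>
        sigma_c_nbhd M E nrm f X \<epsilon> \<subseteq> S \<inter> T"
      using X(1,2) Y(1,2) by (meson finite_UnI Un_least)
  qed
next
  fix \<K> assume "\<forall>K\<in>\<K>. sigma_c_open M E nrm K"
  then show "sigma_c_open M E nrm (\<Union>\<K>)"
    unfolding sigma_c_open_def by (safe; meson UnionI Union_upper subset_trans subsetD)
qed

lemma openin_sigma_c: "openin (sigma_c M E nrm) G \<longleftrightarrow> sigma_c_open M E nrm G"
  unfolding sigma_c_def by (simp add: topology_inverse' istopology_sigma_c_open)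

end

theory Submission
  imports Defs "HOL-Probability.Probability_Mass_Function"
begin

text \<open>If \<open>f\<close> is in the dual unit ball and \<open>f x\<^sub>0\<close> vanishes nowhere on infinitely many disjoint sets
  \<open>B\<^sub>n\<close> of positive probability, then the functionals \<open>1\<^bsub>B\<^sub>n\<^esub> f\<close> stay in the ball but are uniformly
  separated at \<open>x\<^sub>0\<close> relative to the random radius \<open>\<bar>f x\<^sub>0\<bar>\<close>: the locally \<open>L\<^sup>0\<close>-convex topology
  behaves like a box topology, so the ball is not compact. A random Hahn--Banach theorem provides \<open>f\<close> with
  \<open>f x\<^sub>0 \<noteq> 0\<close> wherever \<open>\<parallel>x\<^sub>0\<parallel> \<noteq> 0\<close>. If the complement of all atoms had positive probability, full
  support would give \<open>x\<^sub>0\<close> with \<open>\<parallel>x\<^sub>0\<parallel> \<noteq> 0\<close> on an atomless set of positive probability, which splits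
  into such \<open>B\<^sub>n\<close>. For the counterexample take infinitely many atoms as \<open>B\<^sub>n\<close> and \<open>x\<^sub>0 = 1\<close> in
  \<open>L\<^sup>0\<close> itself.\<close>

section \<open>Essential infima\<close>

text \<open>Extending a functional one vector at a time is awkward over \<open>L0\<close>: this ring
  has zero divisors, so a new vector may be dependent on a submodule over one part of the space and
  independent over another. Hahn--Banach is therefore proved with sublinear functionals defined on
  all of \<open>E\<close> at once, lowered until they are linear. Lowering means taking infima of
  uncountable families of random variables, which make sense only as essential infima; these come
  from countable subfamilies. Everything up to this point uses real scalars, and the complex case is
  derived afterwards.

  In the compactness argument the obstacle is that a basic neighbourhood, given by a non-strict a.e.
  inequality, need not be open. The covering sets are built with a uniform slack factor below 1.
  Their radius is a third of the size of \<open>f x0\<close>: two elements of one such set then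
  differ at \<open>x0\<close> by at most two thirds of it, whereas two of the functionals cut down
  to disjoint sets differ there by all of it.\<close>

lemma (in finite_measure) countable_exhaustion:
  assumes "\<S> \<subseteq> sets M"
  shows "\<exists>D\<subseteq>\<S>. countable D \<and> (\<forall>S\<in>\<S>. measure M (S - \<Union>D) = 0)"
proof -
  define \<D> where "\<D> = {D. D \<subseteq> \<S> \<and> countable D}"
  \<comment> \<open>The supremum over countable subfamilies is attained, because the union of a
    maximizing sequence of countable subfamilies is countable. A further member of
    \<open>\<S>\<close> can then add no mass.\<close>
  define s where "s = (SUP D\<in>\<D>. measure M (\<Union>D))"
  have sets: "\<Union>D \<in> sets M" if "D \<in> \<D>" for D
    using that assms unfolding \<D>_def by (intro sets.countable_Union) auto
  have bdd: "bdd_above ((\<lambda>D. measure M (\<Union>D)) ` \<D>)"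
    by (rule bdd_aboveI[where M = "measure M (space M)"]) (auto intro: bounded_measure)
  have le_s: "measure M (\<Union>D) \<le> s" if "D \<in> \<D>" for D
    unfolding s_def by (rule cSUP_upper[OF that bdd])
  have "{} \<in> \<D>" by (auto simp: \<D>_def)
  then have ne: "\<D> \<noteq> {}" by blast
  have "\<exists>D\<in>\<D>. s - inverse (Suc n) < measure M (\<Union>D)" for n
    using less_cSUP_iff[OF ne bdd, of "s - inverse (Suc n)"] unfolding s_def[symmetric] by simp
  then obtain D where D: "\<And>n. D n \<in> \<D>" "\<And>n. s - inverse (Suc n) < measure M (\<Union>(D n))"
    by metis
  define U where "U = (\<Union>n. D n)"
  have U: "U \<in> \<D>" using D(1) by (auto simp: U_def \<D>_def)
  have "s - inverse (Suc n) \<le> measure M (\<Union>U)" for n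
  proof -
    have "measure M (\<Union>(D n)) \<le> measure M (\<Union>U)"
      by (rule finite_measure_mono) (use sets[OF U] in \<open>auto simp: U_def\<close>)
    then show ?thesis using D(2)[of n] by simp
  qed
  then have "s \<le> measure M (\<Union>U)"
    using LIMSEQ_le_const2[OF tendsto_diff[OF tendsto_const[of s] LIMSEQ_inverse_real_of_nat]]
    by (metis diff_zero)
  then have eq: "measure M (\<Union>U) = s" using le_s[OF U] by simp
  show ?thesis
  proof (intro exI conjI ballI)
    show "U \<subseteq> \<S>" "countable U" using U by (auto simp: \<D>_def)
    fix S assume S: "S \<in> \<S>"
    then have "insert S U \<in> \<D>" using U by (auto simp: \<D>_def)
    from le_s[OF this] have "measure M (S \<union> \<Union>U) \<le> measure M (\<Union>U)" by (simp add: eq)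
    moreover have "measure M (S \<union> \<Union>U) = measure M (\<Union>U) + measure M (S - \<Union>U)"
      using finite_measure_Union[of "\<Union>U" "S - \<Union>U"] S assms sets[OF U] by (auto simp: Un_commute)
    ultimately show "measure M (S - \<Union>U) = 0"
      using measure_nonneg[of M "S - \<Union>U"] by linarith
  qed
qed

text \<open>For each rational \<open>q\<close>, countably many members of \<open>F\<close> exhaust
  all level sets where some \<open>f\<close> is below \<open>q\<close>, up to null sets. Collecting
  them over all \<open>q\<close> suffices: if \<open>f w\<close> were below the countable infimum, a
  rational strictly between the two would put \<open>w\<close> into one of countably many
  exceptional null sets.\<close>

lemma (in finite_measure) countable_ess_inf:
  fixes F :: "('a \<Rightarrow> ereal) set"
  assumes F: "F \<subseteq> borel_measurable M"
  obtains C where "C \<subseteq> F" "countable C" "\<And>f. f \<in> F \<Longrightarrow> AE w in M. (INF c\<in>C. c w) \<le> f w"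
proof -
  define L where "L q f = {w \<in> space M. f w < ereal (real_of_rat q)}" for q and f :: "'a \<Rightarrow> ereal"
  have L: "L q f \<in> sets M" if "f \<in> F" for q f
    using that F unfolding L_def by (intro borel_measurable_less) auto
  have "\<exists>C\<subseteq>F. countable C \<and> (\<forall>f\<in>F. measure M (L q f - \<Union>(L q ` C)) = 0)" for q
  proof -
    have "L q ` F \<subseteq> sets M" using L by auto
    from countable_exhaustion[OF this] obtain D where D: "D \<subseteq> L q ` F" "countable D"
      "\<forall>S\<in>L q ` F. measure M (S - \<Union>D) = 0" by auto
    then obtain C where "C \<subseteq> F" "countable C" "D = L q ` C"
      using countable_subset_image by metis
    then show ?thesis using D(3) by blast
  qed
  then obtain C where C: "\<And>q. C q \<subseteq> F" "\<And>q. countable (C q)"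
    "\<And>q f. f \<in> F \<Longrightarrow> measure M (L q f - \<Union>(L q ` C q)) = 0"
    by metis
  show thesis
  proof (rule that)
    show "(\<Union>q. C q) \<subseteq> F" "countable (\<Union>q. C q)" using C by auto
    fix f assume f: "f \<in> F"
    have "AE w in M. w \<notin> L q f - \<Union>(L q ` C q)" for q
    proof (rule AE_not_in)
      have "\<Union>(L q ` C q) \<in> sets M"
        using C(1,2)[of q] L by (intro sets.countable_UN') auto
      then show "L q f - \<Union>(L q ` C q) \<in> null_sets M"
        using C(3)[OF f, of q] L[OF f] by (auto simp: null_sets_def emeasure_eq_measure)
    qed
    then have "AE w in M. \<forall>q. w \<notin> L q f - \<Union>(L q ` C q)" unfolding AE_all_countable by blast
    with AE_space show "AE w in M. (INF c\<in>(\<Union>q. C q). c w) \<le> f w"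
    proof eventually_elim
      case w: (elim w)
      show ?case
      proof (rule ccontr)
        assume "\<not> ?thesis"
        then have "f w < (INF c\<in>(\<Union>q. C q). c w)" by (rule not_le_imp_less)
        from ereal_dense3[OF this] obtain q where q: "f w < ereal (real_of_rat q)"
          "ereal (real_of_rat q) < (INF c\<in>(\<Union>q. C q). c w)"
          by blast
        then have "w \<in> L q f" using w by (simp add: L_def)
        then obtain c where c: "c \<in> C q" "c w < ereal (real_of_rat q)" using w by (auto simp: L_def)
        then have "(INF c\<in>(\<Union>q. C q). c w) \<le> c w" by (intro INF_lower) auto
        then show False using c(2) q(2) by simp
      qed
    qed
  qed
qed

lemma (in finite_measure) ess_inf_ereal:
  fixes F :: "('a \<Rightarrow> ereal) set"
  assumes F: "F \<subseteq> borel_measurable M"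
  obtains m where "m \<in> borel_measurable M" "\<And>f. f \<in> F \<Longrightarrow> AE w in M. m w \<le> f w"
    "\<And>g. (\<And>f. f \<in> F \<Longrightarrow> AE w in M. g w \<le> f w) \<Longrightarrow> AE w in M. g w \<le> m w"
proof -
  obtain C where C: "C \<subseteq> F" "countable C" "\<And>f. f \<in> F \<Longrightarrow> AE w in M. (INF c\<in>C. c w) \<le> f w"
    using countable_ess_inf[OF F] by blast
  show thesis
  proof (rule that)
    show "(\<lambda>w. INF c\<in>C. c w) \<in> borel_measurable M"
      using C F by (intro borel_measurable_INF) auto
    fix g assume "\<And>f. f \<in> F \<Longrightarrow> AE w in M. g w \<le> f w"
    then have "AE w in M. \<forall>c\<in>C. g w \<le> c w"
      using C by (subst AE_ball_countable) auto
    then show "AE w in M. g w \<le> (INF c\<in>C. c w)"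
      by eventually_elim (auto intro: INF_greatest)
  qed (rule C(3))
qed

text \<open>The extended infimum is a.e. finite: any one member of \<open>F\<close> bounds it above
  and \<open>b\<close> bounds it below. Hence it can be converted back to a real function.\<close>

lemma (in finite_measure) ess_inf_real:
  fixes F :: "('a \<Rightarrow> real) set"
  assumes F: "F \<subseteq> borel_measurable M" "F \<noteq> {}"
    and b: "\<And>f. f \<in> F \<Longrightarrow> AE w in M. b w \<le> f w"
  shows "\<exists>m\<in>borel_measurable M. (\<forall>f\<in>F. AE w in M. m w \<le> f w) \<and>
    (\<forall>g. (\<forall>f\<in>F. AE w in M. g w \<le> f w) \<longrightarrow> (AE w in M. g w \<le> m w))"
proof -
  have "(\<lambda>f w. ereal (f w)) ` F \<subseteq> borel_measurable M" using F by auto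
  then obtain m where m: "m \<in> borel_measurable M"
    "\<And>f. f \<in> (\<lambda>f w. ereal (f w)) ` F \<Longrightarrow> AE w in M. m w \<le> f w"
    "\<And>g. (\<And>f. f \<in> (\<lambda>f w. ereal (f w)) ` F \<Longrightarrow> AE w in M. g w \<le> f w) \<Longrightarrow> AE w in M. g w \<le> m w"
    using ess_inf_ereal by blast
  obtain f0 where f0: "f0 \<in> F" using F by blast
  have up: "AE w in M. m w \<le> ereal (f0 w)" using m(2) f0 by blast
  have lo: "AE w in M. ereal (b w) \<le> m w" using b by (intro m(3)) auto
  have fin: "AE w in M. ereal (real_of_ereal (m w)) = m w"
    using up lo
  proof eventually_elim
    case (elim w)
    then show ?case by (cases "m w") auto
  qed
  show ?thesis
  proof (intro bexI[of _ "\<lambda>w. real_of_ereal (m w)"] conjI ballI allI impI)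
    show "(\<lambda>w. real_of_ereal (m w)) \<in> borel_measurable M" using m(1) by simp
    fix f assume "f \<in> F"
    then have "AE w in M. m w \<le> ereal (f w)" using m(2) by blast
    with fin show "AE w in M. real_of_ereal (m w) \<le> f w"
      by eventually_elim (metis ereal_less_eq(3))
  next
    fix g assume "\<forall>f\<in>F. AE w in M. g w \<le> f w"
    then have "AE w in M. ereal (g w) \<le> m w" by (intro m(3)) auto
    with fin show "AE w in M. g w \<le> real_of_ereal (m w)"
      by eventually_elim (metis ereal_less_eq(3))
  qed
qed

text \<open>The lattice infimum is a Hilbert choice of a greatest lower bound, so nothing is known
  of it until one has been exhibited. The class of the essential infimum of representatives is
  one.\<close>

lemma greatest_L0_inf:
  assumes "finite_measure M" "X \<subseteq> L0 M"
  shows "greatest (L0_ereal_lattice M) (\<Sqinter>\<^bsub>L0_ereal_lattice M\<^esub> X) (Lower (L0_ereal_lattice M) X)"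
proof -
  interpret finite_measure M by fact
  have "L0_rep ` X \<subseteq> borel_measurable M" using assms(2) L0_rep_L0(1) by blast
  then obtain m where m: "m \<in> borel_measurable M"
    "\<And>f. f \<in> L0_rep ` X \<Longrightarrow> AE w in M. m w \<le> f w"
    "\<And>g. (\<And>f. f \<in> L0_rep ` X \<Longrightarrow> AE w in M. g w \<le> f w) \<Longrightarrow> AE w in M. g w \<le> m w"
    using ess_inf_ereal by blast
  note r = L0_rep_class(2)[OF m(1)]
  have "greatest (L0_ereal_lattice M) (L0_class M m) (Lower (L0_ereal_lattice M) X)"
    unfolding greatest_def
  proof (intro conjI ballI)
    show "Lower (L0_ereal_lattice M) X \<subseteq> carrier (L0_ereal_lattice M)" by (simp add: Lower_def)
    have "L0_le M (L0_class M m) x" if "x \<in> X" for x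
    proof -
      have "AE w in M. m w \<le> L0_rep x w" using m(2) that by blast
      with r show ?thesis unfolding L0_le_def by eventually_elim simp
    qed
    then show "L0_class M m \<in> Lower (L0_ereal_lattice M) X"
      using L0_class_in[OF m(1)] by (simp add: Lower_def L0_ereal_lattice_def)
    fix y assume "y \<in> Lower (L0_ereal_lattice M) X"
    then have "AE w in M. L0_rep y w \<le> m w"
      using assms(2) by (intro m(3)) (auto simp: Lower_def L0_ereal_lattice_def L0_le_def)
    with r show "y \<sqsubseteq>\<^bsub>L0_ereal_lattice M\<^esub> L0_class M m"
      unfolding L0_ereal_lattice_def L0_le_def by (simp, eventually_elim) simp
  qed
  then show ?thesis unfolding Lattice.inf_def by (rule someI)
qed

text \<open>The supremum is realized as the infimum of all upper bounds, so no second exhaustion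
  argument is required.\<close>

lemma least_L0_sup:
  assumes "finite_measure M" "X \<subseteq> L0 M"
  shows "least (L0_ereal_lattice M) (\<Squnion>\<^bsub>L0_ereal_lattice M\<^esub> X) (Upper (L0_ereal_lattice M) X)"
proof -
  let ?L = "L0_ereal_lattice M"
  have sub: "Upper ?L X \<subseteq> L0 M" by (auto simp: Upper_def L0_ereal_lattice_def)
  have g: "greatest ?L (\<Sqinter>\<^bsub>?L\<^esub> (Upper ?L X)) (Lower ?L (Upper ?L X))"
    by (rule greatest_L0_inf[OF assms(1) sub])
  have "least ?L (\<Sqinter>\<^bsub>?L\<^esub> (Upper ?L X)) (Upper ?L X)"
    unfolding least_def
  proof (intro conjI ballI)
    show "Upper ?L X \<subseteq> carrier ?L" by (simp add: Upper_def)
    have "x \<in> Lower ?L (Upper ?L X)" if "x \<in> X" for x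
      using that assms(2) by (auto simp: Lower_def Upper_def L0_ereal_lattice_def)
    then have "x \<sqsubseteq>\<^bsub>?L\<^esub> \<Sqinter>\<^bsub>?L\<^esub> (Upper ?L X)" if "x \<in> X" for x
      using g that unfolding greatest_def by blast
    moreover have "\<Sqinter>\<^bsub>?L\<^esub> (Upper ?L X) \<in> carrier ?L"
      using g by (auto simp: greatest_def Lower_def)
    ultimately show "\<Sqinter>\<^bsub>?L\<^esub> (Upper ?L X) \<in> Upper ?L X" by (simp add: Upper_def)
    fix y assume "y \<in> Upper ?L X"
    then show "\<Sqinter>\<^bsub>?L\<^esub> (Upper ?L X) \<sqsubseteq>\<^bsub>?L\<^esub> y"
      using g sub unfolding greatest_def Lower_def by (auto simp: L0_ereal_lattice_def)
  qed
  then show ?thesis unfolding Lattice.sup_def by (rule someI)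
qed

section \<open>Random variables modulo almost sure equality\<close>

lemma L0_eqI:
  assumes "X \<in> L0 M" "Y \<in> L0 M" "AE w in M. L0_rep X w = L0_rep Y w"
  shows "X = Y"
  using L0_class_eqI[OF assms(3)] L0_rep_L0(2)[OF assms(1)] L0_rep_L0(2)[OF assms(2)] by simp

lemma carrier_L0_ring: "carrier (L0_ring M) = L0 M"
  by (simp add: L0_ring_def)

lemma
  fixes X Y :: "('w \<Rightarrow> 'k::{real_normed_field, second_countable_topology}) set"
  assumes X: "X \<in> L0 M" and Y: "Y \<in> L0 M"
  shows L0_rep_add: "AE w in M. L0_rep (X \<oplus>\<^bsub>L0_ring M\<^esub> Y) w = L0_rep X w + L0_rep Y w"
    and L0_rep_mult: "AE w in M. L0_rep (X \<otimes>\<^bsub>L0_ring M\<^esub> Y) w = L0_rep X w * L0_rep Y w"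
  using L0_rep_class(2)[OF borel_measurable_add[OF L0_rep_L0(1)[OF X] L0_rep_L0(1)[OF Y]]]
    L0_rep_class(2)[OF borel_measurable_times[OF L0_rep_L0(1)[OF X] L0_rep_L0(1)[OF Y]]]
  by (simp_all add: L0_ring_def)

lemma
  fixes X :: "('w \<Rightarrow> 'k::{real_normed_field, second_countable_topology}) set"
  assumes X: "X \<in> L0 M"
  shows L0_abs_in: "L0_abs M X \<in> L0 M"
    and L0_rep_abs: "AE w in M. L0_rep (L0_abs M X) w = norm (L0_rep X w)"
  unfolding L0_abs_def using L0_rep_L0(1)[OF X] by (auto intro!: L0_class_in L0_rep_class(2))

lemma L0_rep_zero: "AE w in M. L0_rep (\<zero>\<^bsub>L0_ring M\<^esub>) w = 0"
  unfolding L0_ring_def by (simp add: L0_rep_class(2))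

text \<open>Subtraction in the ring goes through an abstract additive inverse. Its representative is
  found by solving (X - Y) + Y = X with the rule for sums.\<close>

lemma L0_rep_minus:
  fixes X Y :: "('w \<Rightarrow> 'k::{real_normed_field, second_countable_topology}) set"
  assumes X: "X \<in> L0 M" and Y: "Y \<in> L0 M"
  shows "AE w in M. L0_rep (X \<ominus>\<^bsub>L0_ring M\<^esub> Y) w = L0_rep X w - L0_rep Y w"
proof -
  interpret R: cring "L0_ring M :: ('w \<Rightarrow> 'k) set ring" by (rule cring_L0_ring)
  have D: "X \<ominus>\<^bsub>L0_ring M\<^esub> Y \<in> L0 M" using R.minus_closed[of X Y] X Y by (simp add: carrier_L0_ring)
  have "(X \<ominus>\<^bsub>L0_ring M\<^esub> Y) \<oplus>\<^bsub>L0_ring M\<^esub> Y = X"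
    using X Y unfolding carrier_L0_ring[symmetric] by (simp add: R.minus_eq R.a_assoc R.l_neg)
  then have "AE w in M. L0_rep X w = L0_rep (X \<ominus>\<^bsub>L0_ring M\<^esub> Y) w + L0_rep Y w"
    using L0_rep_add[OF D Y] by simp
  then show ?thesis by eventually_elim simp
qed

section \<open>The random Hahn--Banach theorem\<close>

text \<open>Second countability of \<open>'k\<close> is added so that sums and products of
  measurable functions are measurable and \<open>L0_ring M\<close> is a commutative ring. Both
  \<open>real\<close> and \<open>complex\<close> qualify.\<close>

locale rn_module = random_normed_module M E nrm
  for M :: "'w measure"
    and E :: "(('w \<Rightarrow> 'k::{real_normed_field, second_countable_topology}) set, 'e, 'm) module_scheme"
    and nrm :: "'e \<Rightarrow> ('w \<Rightarrow> real) set"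
begin

section \<open>Norm and scalar multiplication expressed by functions instead of classes\<close>

definition N :: "'e \<Rightarrow> 'w \<Rightarrow> real" where "N x = L0_rep (nrm x)"

definition scale :: "('w \<Rightarrow> 'k) \<Rightarrow> 'e \<Rightarrow> 'e" where "scale \<xi> x = L0_class M \<xi> \<odot>\<^bsub>E\<^esub> x"

lemma ring_class:
  assumes "\<xi> \<in> borel_measurable M" "\<eta> \<in> borel_measurable M"
  shows "L0_class M (\<lambda>w. \<xi> w + \<eta> w :: 'k) = L0_class M \<xi> \<oplus>\<^bsub>L0_ring M\<^esub> L0_class M \<eta>"
    and "L0_class M (\<lambda>w. \<xi> w * \<eta> w) = L0_class M \<xi> \<otimes>\<^bsub>L0_ring M\<^esub> L0_class M \<eta>"
  using L0_rep_class(2)[OF assms(1)] L0_rep_class(2)[OF assms(2)]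
  by (auto simp: L0_ring_def intro!: L0_class_eqI)

lemma scale_closed [simp]:
  "\<xi> \<in> borel_measurable M \<Longrightarrow> x \<in> carrier E \<Longrightarrow> scale \<xi> x \<in> carrier E"
  unfolding scale_def by (simp add: L0_class_in carrier_L0_ring)

lemma scale_add_left:
  assumes "\<xi> \<in> borel_measurable M" "\<eta> \<in> borel_measurable M" "x \<in> carrier E"
  shows "scale (\<lambda>w. \<xi> w + \<eta> w) x = scale \<xi> x \<oplus>\<^bsub>E\<^esub> scale \<eta> x"
  unfolding scale_def using assms by (simp add: ring_class smult_l_distr L0_class_in carrier_L0_ring)

lemma scale_add_right:
  assumes "\<xi> \<in> borel_measurable M" "x \<in> carrier E" "y \<in> carrier E"
  shows "scale \<xi> (x \<oplus>\<^bsub>E\<^esub> y) = scale \<xi> x \<oplus>\<^bsub>E\<^esub> scale \<xi> y"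
  unfolding scale_def using assms by (simp add: smult_r_distr L0_class_in carrier_L0_ring)

lemma scale_scale:
  assumes "\<xi> \<in> borel_measurable M" "\<eta> \<in> borel_measurable M" "x \<in> carrier E"
  shows "scale \<xi> (scale \<eta> x) = scale (\<lambda>w. \<xi> w * \<eta> w) x"
  unfolding scale_def using assms by (simp add: ring_class smult_assoc1 L0_class_in carrier_L0_ring)

lemma scale_one: "x \<in> carrier E \<Longrightarrow> scale (\<lambda>w. 1) x = x"
proof -
  assume x: "x \<in> carrier E"
  have "L0_class M (\<lambda>w. 1 :: 'k) = \<one>\<^bsub>L0_ring M\<^esub>" by (simp add: L0_ring_def)
  then show ?thesis unfolding scale_def by (simp add: x)
qed

lemma scale_zero: "x \<in> carrier E \<Longrightarrow> scale (\<lambda>w. 0) x = \<zero>\<^bsub>E\<^esub>"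
proof -
  assume x: "x \<in> carrier E"
  have "L0_class M (\<lambda>w. 0 :: 'k) = \<zero>\<^bsub>L0_ring M\<^esub>" by (simp add: L0_ring_def)
  then show ?thesis unfolding scale_def by (simp add: x)
qed

lemma nrm_in: "x \<in> carrier E \<Longrightarrow> nrm x \<in> L0 M"
  using nrm_in_L0_plus by (auto simp: L0_plus_def)

lemma N_scale:
  assumes \<xi>: "\<xi> \<in> borel_measurable M" and x: "x \<in> carrier E"
  shows "AE w in M. N (scale \<xi> x) w = norm (\<xi> w) * N x w"
proof -
  have c: "L0_class M \<xi> \<in> L0 M" by (rule L0_class_in[OF \<xi>])
  show ?thesis
    using L0_rep_mult[OF L0_abs_in[OF c] nrm_in[OF x]] L0_rep_abs[OF c] L0_rep_class(2)[OF \<xi>]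
    unfolding N_def scale_def nrm_smult[OF c x] by eventually_elim simp
qed

lemma N_measurable: "x \<in> carrier E \<Longrightarrow> N x \<in> borel_measurable M"
  by (simp add: N_def L0_rep_L0 nrm_in)

lemma N_nonneg:
  assumes "x \<in> carrier E"
  shows "AE w in M. 0 \<le> N x w"
proof -
  have "AE w in M. L0_rep (L0_class M (\<lambda>w. 0)) w \<le> N x w"
    using nrm_in_L0_plus[OF assms] by (simp add: N_def L0_plus_def L0_le_def)
  moreover have "AE w in M. L0_rep (L0_class M (\<lambda>w. 0)) w = (0 :: real)"
    by (rule L0_rep_class(2)) simp
  ultimately show ?thesis by eventually_elim simp
qed

lemma N_add:
  assumes "x \<in> carrier E" "y \<in> carrier E"
  shows "AE w in M. N (x \<oplus>\<^bsub>E\<^esub> y) w \<le> N x w + N y w"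
  using nrm_triangle[OF assms] L0_rep_add[OF nrm_in[OF assms(1)] nrm_in[OF assms(2)]]
  unfolding N_def L0_le_def by eventually_elim simp

text \<open>Restricting scalars to real random variables lets one Hahn--Banach argument serve both
  fields; order, and hence sublinearity, is available only there.\<close>

definition rscale :: "('w \<Rightarrow> real) \<Rightarrow> 'e \<Rightarrow> 'e" where
  "rscale \<xi> = scale (\<lambda>w. of_real (\<xi> w))"

lemma rscale_closed [simp]:
  "\<xi> \<in> borel_measurable M \<Longrightarrow> x \<in> carrier E \<Longrightarrow> rscale \<xi> x \<in> carrier E"
  unfolding rscale_def by (rule scale_closed) auto

lemma rscale_add_left:
  assumes "\<xi> \<in> borel_measurable M" "\<eta> \<in> borel_measurable M" "x \<in> carrier E"
  shows "rscale (\<lambda>w. \<xi> w + \<eta> w) x = rscale \<xi> x \<oplus>\<^bsub>E\<^esub> rscale \<eta> x"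
  unfolding rscale_def using assms by (simp add: scale_add_left)

lemma rscale_add_right:
  assumes "\<xi> \<in> borel_measurable M" "x \<in> carrier E" "y \<in> carrier E"
  shows "rscale \<xi> (x \<oplus>\<^bsub>E\<^esub> y) = rscale \<xi> x \<oplus>\<^bsub>E\<^esub> rscale \<xi> y"
  unfolding rscale_def using assms by (simp add: scale_add_right)

lemma rscale_rscale:
  assumes "\<xi> \<in> borel_measurable M" "\<eta> \<in> borel_measurable M" "x \<in> carrier E"
  shows "rscale \<xi> (rscale \<eta> x) = rscale (\<lambda>w. \<xi> w * \<eta> w) x"
  unfolding rscale_def using assms by (simp add: scale_scale)

lemma rscale_one: "x \<in> carrier E \<Longrightarrow> rscale (\<lambda>w. 1) x = x"
  unfolding rscale_def by (simp add: scale_one)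

lemma rscale_zero: "x \<in> carrier E \<Longrightarrow> rscale (\<lambda>w. 0) x = \<zero>\<^bsub>E\<^esub>"
  unfolding rscale_def by (simp add: scale_zero)

lemma N_rscale:
  assumes "\<xi> \<in> borel_measurable M" "x \<in> carrier E"
  shows "AE w in M. N (rscale \<xi> x) w = \<bar>\<xi> w\<bar> * N x w"
  using N_scale[of "\<lambda>w. of_real (\<xi> w)" x] assms unfolding rscale_def by simp

text \<open>The additive inverse is written as a scaling so that its norm is given by
  \<open>N_rscale\<close>.\<close>

definition neg :: "'e \<Rightarrow> 'e" where "neg = rscale (\<lambda>w. - 1)"

lemma neg_closed: "x \<in> carrier E \<Longrightarrow> neg x \<in> carrier E"
  unfolding neg_def by (rule rscale_closed) auto

lemma add_neg:
  assumes "x \<in> carrier E"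
  shows "x \<oplus>\<^bsub>E\<^esub> neg x = \<zero>\<^bsub>E\<^esub>"
proof -
  have "rscale (\<lambda>w. 1) x \<oplus>\<^bsub>E\<^esub> rscale (\<lambda>w. -1) x = rscale (\<lambda>w. 1 + - 1) x"
    by (rule rscale_add_left[symmetric]) (use assms in auto)
  then show ?thesis using assms by (simp add: neg_def rscale_one rscale_zero)
qed

lemma rscale_zero_right:
  assumes "\<xi> \<in> borel_measurable M"
  shows "rscale \<xi> \<zero>\<^bsub>E\<^esub> = \<zero>\<^bsub>E\<^esub>"
  using rscale_rscale[OF assms, of "\<lambda>w. 0" "\<zero>\<^bsub>E\<^esub>"] by (simp add: rscale_zero)

text \<open>A minimal sublinear functional is linear: \<open>q x = inf (p (x + \<xi> y) - \<xi> p y)\<close> over \<open>\<xi> > 0\<close>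
  is again sublinear and below \<open>p\<close>. Homogeneity is demanded only for strictly positive \<open>\<xi>\<close>,
  which makes it stable under infima.\<close>

definition sublin :: "('e \<Rightarrow> ('w \<Rightarrow> real) set) \<Rightarrow> bool" where
  "sublin p \<longleftrightarrow> p \<in> carrier E \<rightarrow>\<^sub>E L0 M \<and>
    (\<forall>x\<in>carrier E. \<forall>y\<in>carrier E.
      AE w in M. L0_rep (p (x \<oplus>\<^bsub>E\<^esub> y)) w \<le> L0_rep (p x) w + L0_rep (p y) w) \<and>
    (\<forall>\<xi>\<in>borel_measurable M. (\<forall>w. 0 < \<xi> w) \<longrightarrow> (\<forall>x\<in>carrier E.
      AE w in M. L0_rep (p (rscale \<xi> x)) w \<le> \<xi> w * L0_rep (p x) w)) \<and>
    (\<forall>x\<in>carrier E. AE w in M. L0_rep (p x) w \<le> N x w)"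

lemma
  assumes "sublin p"
  shows sublin_in: "x \<in> carrier E \<Longrightarrow> p x \<in> L0 M"
    and sublin_measurable: "x \<in> carrier E \<Longrightarrow> L0_rep (p x) \<in> borel_measurable M"
    and sublin_add: "x \<in> carrier E \<Longrightarrow> y \<in> carrier E \<Longrightarrow>
      AE w in M. L0_rep (p (x \<oplus>\<^bsub>E\<^esub> y)) w \<le> L0_rep (p x) w + L0_rep (p y) w"
    and sublin_rscale: "\<xi> \<in> borel_measurable M \<Longrightarrow> (\<And>w. 0 < \<xi> w) \<Longrightarrow> x \<in> carrier E \<Longrightarrow>
      AE w in M. L0_rep (p (rscale \<xi> x)) w \<le> \<xi> w * L0_rep (p x) w"
    and sublin_le: "x \<in> carrier E \<Longrightarrow> AE w in M. L0_rep (p x) w \<le> N x w"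
  using assms unfolding sublin_def by (auto intro: L0_rep_L0(1))

lemma sublin_neg:
  assumes p: "sublin p" and x: "x \<in> carrier E"
  shows "AE w in M. - L0_rep (p (neg x)) w \<le> L0_rep (p x) w"
proof -
  \<comment> \<open>Doubling the zero vector yields p(0) \<le> 2 p(0), so p(0) is a.e. nonnegative.
    Subadditivity on x + (-x) = 0 does the rest.\<close>
  have "AE w in M. L0_rep (p (rscale (\<lambda>w. 2) \<zero>\<^bsub>E\<^esub>)) w \<le> 2 * L0_rep (p \<zero>\<^bsub>E\<^esub>) w"
    by (rule sublin_rscale[OF p]) auto
  then have "AE w in M. L0_rep (p \<zero>\<^bsub>E\<^esub>) w \<le> 2 * L0_rep (p \<zero>\<^bsub>E\<^esub>) w"
    by (simp add: rscale_zero_right)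
  moreover have "AE w in M. L0_rep (p \<zero>\<^bsub>E\<^esub>) w \<le> L0_rep (p x) w + L0_rep (p (neg x)) w"
    using sublin_add[OF p x neg_closed[OF x]] by (simp add: add_neg x)
  ultimately show ?thesis by eventually_elim simp
qed

text \<open>This lower bound is the same for all sublinear functionals, which keeps the infimum of a
  whole chain of them finite.\<close>

lemma sublin_ge:
  assumes p: "sublin p" and x: "x \<in> carrier E"
  shows "AE w in M. - N x w \<le> L0_rep (p x) w"
proof -
  have "AE w in M. N (neg x) w = \<bar>-1\<bar> * N x w" unfolding neg_def by (rule N_rscale) (use x in auto)
  then show ?thesis
    using sublin_neg[OF p x] sublin_le[OF p neg_closed[OF x]] by eventually_elim simp
qed

text \<open>Shared by the lowering of a single functional and by the lower bound of a chain.
  \<open>F x\<close> is the set of candidate values at \<open>x\<close>; if candidates can be added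
  and positively scaled up to a.e. domination, their essential infima inherit sublinearity. The
  bound \<open>b\<close> guarantees that these infima are finite.\<close>

lemma inf_sublin:
  fixes F :: "'e \<Rightarrow> ('w \<Rightarrow> real) set"
  assumes meas: "\<And>x. x \<in> carrier E \<Longrightarrow> F x \<subseteq> borel_measurable M"
    and low: "\<And>x u. x \<in> carrier E \<Longrightarrow> u \<in> F x \<Longrightarrow> AE w in M. b x w \<le> u w"
    and add: "\<And>x y u v. x \<in> carrier E \<Longrightarrow> y \<in> carrier E \<Longrightarrow> u \<in> F x \<Longrightarrow> v \<in> F y \<Longrightarrow>
      \<exists>t\<in>F (x \<oplus>\<^bsub>E\<^esub> y). AE w in M. t w \<le> u w + v w"
    and sc: "\<And>x u \<xi>. x \<in> carrier E \<Longrightarrow> u \<in> F x \<Longrightarrow> \<xi> \<in> borel_measurable M \<Longrightarrow> (\<And>w. 0 < \<xi> w) \<Longrightarrow>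
      \<exists>t\<in>F (rscale \<xi> x). AE w in M. t w \<le> \<xi> w * u w"
    and le: "\<And>x. x \<in> carrier E \<Longrightarrow> \<exists>t\<in>F x. AE w in M. t w \<le> N x w"
  shows "\<exists>p. sublin p \<and> (\<forall>x\<in>carrier E. \<forall>u\<in>F x. AE w in M. L0_rep (p x) w \<le> u w)"
proof -
  define is_inf where "is_inf x m \<longleftrightarrow> m \<in> borel_measurable M \<and> (\<forall>f\<in>F x. AE w in M. m w \<le> f w) \<and>
      (\<forall>g. (\<forall>f\<in>F x. AE w in M. g w \<le> f w) \<longrightarrow> (AE w in M. g w \<le> m w))" for x m
  have "\<exists>m. is_inf x m"
    if x: "x \<in> carrier E" for x
  proof -
    have "F x \<noteq> {}" using le[OF x] by auto
    from ess_inf_real[OF meas[OF x] this low[OF x]] show ?thesis by (auto simp: is_inf_def)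
  qed
  then obtain m where "\<And>x. x \<in> carrier E \<Longrightarrow> is_inf x (m x)" by metis
  then have m: "\<And>x. x \<in> carrier E \<Longrightarrow> m x \<in> borel_measurable M"
    "\<And>x f. x \<in> carrier E \<Longrightarrow> f \<in> F x \<Longrightarrow> AE w in M. m x w \<le> f w"
    "\<And>x g. x \<in> carrier E \<Longrightarrow> (\<And>f. f \<in> F x \<Longrightarrow> AE w in M. g w \<le> f w) \<Longrightarrow> AE w in M. g w \<le> m x w"
    unfolding is_inf_def by auto
  define p where "p = (\<lambda>x\<in>carrier E. L0_class M (m x))"
  have p: "p x \<in> L0 M" "AE w in M. L0_rep (p x) w = m x w" if "x \<in> carrier E" for x
    using that m(1)[OF that] by (auto simp: p_def intro: L0_class_in L0_rep_class(2))
  have "sublin p"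
    unfolding sublin_def
  proof (intro conjI ballI impI)
    show "p \<in> carrier E \<rightarrow>\<^sub>E L0 M" using p(1) by (auto simp: p_def)
  next
    fix x y assume x: "x \<in> carrier E" and y: "y \<in> carrier E"
    have xy: "x \<oplus>\<^bsub>E\<^esub> y \<in> carrier E" using x y by simp
    \<comment> \<open>Of \<open>m\<close> only the greatest-lower-bound property is known, and the
      families may be uncountable. So the infimum of u + v is taken in one variable at a time: over
      u with v fixed, then over v.\<close>
    have *: "AE w in M. m (x \<oplus>\<^bsub>E\<^esub> y) w - v w \<le> u w" if uv: "u \<in> F x" "v \<in> F y" for u v
    proof -
      obtain t where "t \<in> F (x \<oplus>\<^bsub>E\<^esub> y)" "AE w in M. t w \<le> u w + v w" using add[OF x y uv] by blast
      from m(2)[OF xy this(1)] this(2) show ?thesis by eventually_elim simp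
    qed
    have "AE w in M. m (x \<oplus>\<^bsub>E\<^esub> y) w - m x w \<le> v w" if v: "v \<in> F y" for v
    proof -
      have "AE w in M. m (x \<oplus>\<^bsub>E\<^esub> y) w - v w \<le> m x w" by (rule m(3)[OF x *[OF _ v]])
      then show ?thesis by eventually_elim simp
    qed
    then have "AE w in M. m (x \<oplus>\<^bsub>E\<^esub> y) w - m x w \<le> m y w" by (rule m(3)[OF y])
    with p(2)[OF x] p(2)[OF y] p(2)[OF xy]
    show "AE w in M. L0_rep (p (x \<oplus>\<^bsub>E\<^esub> y)) w \<le> L0_rep (p x) w + L0_rep (p y) w"
      by eventually_elim simp
  next
    fix \<xi> :: "'w \<Rightarrow> real" and x assume \<xi>: "\<xi> \<in> borel_measurable M" "\<forall>w. 0 < \<xi> w" and x: "x \<in> carrier E"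
    have sx: "rscale \<xi> x \<in> carrier E" by (rule rscale_closed[OF \<xi>(1) x])
    have "AE w in M. m (rscale \<xi> x) w / \<xi> w \<le> u w" if u: "u \<in> F x" for u
    proof -
      obtain t where "t \<in> F (rscale \<xi> x)" "AE w in M. t w \<le> \<xi> w * u w"
        using sc[OF x u \<xi>(1)] \<xi>(2) by blast
      from m(2)[OF sx this(1)] this(2) show ?thesis
        by eventually_elim (use \<xi>(2) in \<open>simp add: divide_le_eq mult.commute\<close>)
    qed
    then have "AE w in M. m (rscale \<xi> x) w / \<xi> w \<le> m x w" by (rule m(3)[OF x])
    with p(2)[OF x] p(2)[OF sx]
    show "AE w in M. L0_rep (p (rscale \<xi> x)) w \<le> \<xi> w * L0_rep (p x) w"
      by eventually_elim (use \<xi>(2) in \<open>simp add: divide_le_eq mult.commute\<close>)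
  next
    fix x assume x: "x \<in> carrier E"
    obtain t where "t \<in> F x" "AE w in M. t w \<le> N x w" using le[OF x] by blast
    from m(2)[OF x this(1)] this(2) p(2)[OF x] show "AE w in M. L0_rep (p x) w \<le> N x w"
      by eventually_elim simp
  qed
  moreover have "AE w in M. L0_rep (p x) w \<le> u w" if "x \<in> carrier E" "u \<in> F x" for x u
    using m(2)[OF that] p(2)[OF that(1)] by eventually_elim simp
  ultimately show ?thesis by blast
qed

text \<open>If \<open>p\<close> is minimal, then q = p and the last conclusion says p(-y) \<le>
  -p(y), the missing half of oddness. Applied instead to the norm and a given vector, the same
  conclusion prescribes the value at that vector.\<close>

lemma sublin_reduce:
  assumes p: "sublin p" and y: "y \<in> carrier E"
  obtains q where "sublin q" "\<And>x. x \<in> carrier E \<Longrightarrow> AE w in M. L0_rep (q x) w \<le> L0_rep (p x) w"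
    "AE w in M. L0_rep (q (neg y)) w \<le> - L0_rep (p y) w"
proof -
  define Pos where "Pos = {\<xi> :: 'w \<Rightarrow> real. \<xi> \<in> borel_measurable M \<and> (\<forall>w. 0 < \<xi> w)}"
  define u where "u \<xi> x w = L0_rep (p (x \<oplus>\<^bsub>E\<^esub> rscale \<xi> y)) w - \<xi> w * L0_rep (p y) w" for \<xi> x w
  define F where "F x = (\<lambda>\<xi>. u \<xi> x) ` Pos" for x
  have one: "(\<lambda>w. 1) \<in> Pos" by (simp add: Pos_def)
  have sy: "rscale \<xi> y \<in> carrier E" if "\<xi> \<in> Pos" for \<xi>
    using that y by (intro rscale_closed) (auto simp: Pos_def)
  have sc: "AE w in M. L0_rep (p (rscale \<xi> x)) w \<le> \<xi> w * L0_rep (p x) w" if "\<xi> \<in> Pos" "x \<in> carrier E" for \<xi> x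
    using that by (intro sublin_rscale[OF p]) (auto simp: Pos_def)
  have up: "AE w in M. u \<xi> x w \<le> L0_rep (p x) w" if \<xi>: "\<xi> \<in> Pos" and x: "x \<in> carrier E" for \<xi> x
    using sublin_add[OF p x sy[OF \<xi>]] sc[OF \<xi> y] by eventually_elim (simp add: u_def)
  have "\<exists>q. sublin q \<and> (\<forall>x\<in>carrier E. \<forall>u\<in>F x. AE w in M. L0_rep (q x) w \<le> u w)"
  proof (rule inf_sublin)
    fix x assume x: "x \<in> carrier E"
    show "F x \<subseteq> borel_measurable M"
    proof
      fix f assume "f \<in> F x"
      then obtain \<xi> where \<xi>: "\<xi> \<in> Pos" "f = u \<xi> x" by (auto simp: F_def)
      have [measurable]: "\<xi> \<in> borel_measurable M" using \<xi> by (simp add: Pos_def)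
      have [measurable]: "L0_rep (p (x \<oplus>\<^bsub>E\<^esub> rscale \<xi> y)) \<in> borel_measurable M" "L0_rep (p y) \<in> borel_measurable M"
        using sublin_measurable[OF p] sy[OF \<xi>(1)] x y by auto
      show "f \<in> borel_measurable M" unfolding \<xi>(2) u_def by measurable
    qed
    show "\<exists>t\<in>F x. AE w in M. t w \<le> N x w"
    proof
      show "u (\<lambda>w. 1) x \<in> F x" using one by (simp add: F_def)
      show "AE w in M. u (\<lambda>w. 1) x w \<le> N x w"
        using up[OF one x] sublin_le[OF p x] by eventually_elim simp
    qed
  next
    fix x f assume x: "x \<in> carrier E" and "f \<in> F x"
    then obtain \<xi> where \<xi>: "\<xi> \<in> Pos" "f = u \<xi> x" by (auto simp: F_def)
    have [measurable]: "\<xi> \<in> borel_measurable M" and pos: "\<And>w. 0 < \<xi> w" using \<xi> by (auto simp: Pos_def)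
    define z where "z = rscale \<xi> y"
    have z: "z \<in> carrier E" using sy[OF \<xi>(1)] by (simp add: z_def)
    \<comment> \<open>Homogeneity is only known as p(\<xi> y) \<le> \<xi> p(y). Using it for 1/\<xi>
      on \<xi> y gives the reverse inequality. With p(\<xi> y) \<le> p(x + \<xi> y) + p(-x) this
      bounds all candidates at x below by -p(-x).\<close>
    have "rscale (\<lambda>w. 1 / \<xi> w) z = rscale (\<lambda>w. 1 / \<xi> w * \<xi> w) y"
      unfolding z_def by (rule rscale_rscale) (use y in auto)
    also have "(\<lambda>w. 1 / \<xi> w * \<xi> w) = (\<lambda>w. 1)" using pos by (auto simp: less_imp_neq[symmetric])
    finally have zy: "rscale (\<lambda>w. 1 / \<xi> w) z = y" using y by (simp add: rscale_one)
    have "AE w in M. L0_rep (p (rscale (\<lambda>w. 1 / \<xi> w) z)) w \<le> 1 / \<xi> w * L0_rep (p z) w"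
      by (rule sublin_rscale[OF p _ _ z]) (use pos in auto)
    then have 1: "AE w in M. \<xi> w * L0_rep (p y) w \<le> L0_rep (p z) w"
      unfolding zy by eventually_elim (use pos in \<open>simp add: le_divide_eq mult.commute\<close>)
    have "z = (x \<oplus>\<^bsub>E\<^esub> z) \<oplus>\<^bsub>E\<^esub> neg x"
      using add_neg[OF x] x z neg_closed[OF x] by (metis E.M.a_assoc E.M.a_comm E.M.r_zero)
    then have "AE w in M. L0_rep (p z) w \<le> L0_rep (p (x \<oplus>\<^bsub>E\<^esub> z)) w + L0_rep (p (neg x)) w"
      using sublin_add[OF p _ neg_closed[OF x], of "x \<oplus>\<^bsub>E\<^esub> z"] x z by simp
    with 1 show "AE w in M. - L0_rep (p (neg x)) w \<le> f w"
      unfolding \<xi>(2) u_def z_def[symmetric] by eventually_elim simp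
  next
    fix x x' f f' assume x: "x \<in> carrier E" and x': "x' \<in> carrier E" and "f \<in> F x" "f' \<in> F x'"
    then obtain \<xi> \<xi>' where \<xi>: "\<xi> \<in> Pos" "f = u \<xi> x" "\<xi>' \<in> Pos" "f' = u \<xi>' x'" by (auto simp: F_def)
    have s: "(\<lambda>w. \<xi> w + \<xi>' w) \<in> Pos" using \<xi> by (auto simp: Pos_def add_pos_pos)
    have "rscale (\<lambda>w. \<xi> w + \<xi>' w) y = rscale \<xi> y \<oplus>\<^bsub>E\<^esub> rscale \<xi>' y"
      using \<xi> y by (intro rscale_add_left) (auto simp: Pos_def)
    then have eq: "(x \<oplus>\<^bsub>E\<^esub> x') \<oplus>\<^bsub>E\<^esub> rscale (\<lambda>w. \<xi> w + \<xi>' w) y = (x \<oplus>\<^bsub>E\<^esub> rscale \<xi> y) \<oplus>\<^bsub>E\<^esub> (x' \<oplus>\<^bsub>E\<^esub> rscale \<xi>' y)"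
      using x x' sy[OF \<xi>(1)] sy[OF \<xi>(3)] by (simp add: E.M.a_ac)
    have "AE w in M. u (\<lambda>w. \<xi> w + \<xi>' w) (x \<oplus>\<^bsub>E\<^esub> x') w \<le> f w + f' w"
      using sublin_add[OF p E.M.a_closed[OF x sy[OF \<xi>(1)]] E.M.a_closed[OF x' sy[OF \<xi>(3)]]]
      unfolding u_def eq \<xi>(2,4) by eventually_elim (simp add: algebra_simps)
    then show "\<exists>t\<in>F (x \<oplus>\<^bsub>E\<^esub> x'). AE w in M. t w \<le> f w + f' w"
      using s unfolding F_def by blast
  next
    fix x f and \<eta> :: "'w \<Rightarrow> real" assume x: "x \<in> carrier E" and f: "f \<in> F x" and \<eta>: "\<eta> \<in> borel_measurable M" "\<And>w. 0 < \<eta> w"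
    obtain \<xi> where \<xi>: "\<xi> \<in> Pos" "f = u \<xi> x" using f by (auto simp: F_def)
    have \<eta>': "\<eta> \<in> Pos" using \<eta> by (simp add: Pos_def)
    have s: "(\<lambda>w. \<eta> w * \<xi> w) \<in> Pos" using \<xi> \<eta> by (auto simp: Pos_def)
    have "rscale \<eta> (x \<oplus>\<^bsub>E\<^esub> rscale \<xi> y) = rscale \<eta> x \<oplus>\<^bsub>E\<^esub> rscale \<eta> (rscale \<xi> y)"
      by (rule rscale_add_right) (use \<eta> x sy[OF \<xi>(1)] in auto)
    also have "rscale \<eta> (rscale \<xi> y) = rscale (\<lambda>w. \<eta> w * \<xi> w) y"
      using \<eta> \<xi> y by (intro rscale_rscale) (auto simp: Pos_def)
    finally have eq: "rscale \<eta> x \<oplus>\<^bsub>E\<^esub> rscale (\<lambda>w. \<eta> w * \<xi> w) y = rscale \<eta> (x \<oplus>\<^bsub>E\<^esub> rscale \<xi> y)" ..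
    have c: "x \<oplus>\<^bsub>E\<^esub> rscale \<xi> y \<in> carrier E" using x sy[OF \<xi>(1)] by simp
    have "AE w in M. u (\<lambda>w. \<eta> w * \<xi> w) (rscale \<eta> x) w \<le> \<eta> w * f w"
      using sc[OF \<eta>' c] unfolding u_def eq \<xi>(2) by eventually_elim (simp add: algebra_simps)
    then show "\<exists>t\<in>F (rscale \<eta> x). AE w in M. t w \<le> \<eta> w * f w"
      using s unfolding F_def by blast
  qed
  then obtain q where q: "sublin q" "\<And>x \<xi>. x \<in> carrier E \<Longrightarrow> \<xi> \<in> Pos \<Longrightarrow> AE w in M. L0_rep (q x) w \<le> u \<xi> x w"
    unfolding F_def by auto
  show thesis
  proof (rule that[OF q(1)])
    fix x assume x: "x \<in> carrier E"
    show "AE w in M. L0_rep (q x) w \<le> L0_rep (p x) w"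
      using q(2)[OF x one] up[OF one x] by eventually_elim simp
  next
    \<comment> \<open>The candidate with \<xi> = 1 at -y is p(0) - p(y), and p(0) is at most the
      norm of zero, which vanishes.\<close>
    have z: "neg y \<oplus>\<^bsub>E\<^esub> rscale (\<lambda>w. 1) y = \<zero>\<^bsub>E\<^esub>"
      using y add_neg[OF y] neg_closed[OF y] by (simp add: rscale_one E.M.a_comm)
    have 0: "\<zero>\<^bsub>E\<^esub> \<in> carrier E" by simp
    have "AE w in M. N \<zero>\<^bsub>E\<^esub> w = 0"
      using L0_rep_zero[of M] nrm_eq_zero_iff[OF 0] unfolding N_def by simp
    with sublin_le[OF p 0] q(2)[OF neg_closed[OF y] one]
    show "AE w in M. L0_rep (q (neg y)) w \<le> - L0_rep (p y) w"
      unfolding u_def z by eventually_elim simp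
  qed
qed

lemma N_sublin: obtains p where "sublin p" "\<And>x. x \<in> carrier E \<Longrightarrow> AE w in M. L0_rep (p x) w = N x w"
proof -
  have "nrm x \<in> L0 M" if "x \<in> carrier E" for x using nrm_in_L0_plus[OF that] by (simp add: L0_plus_def)
  moreover have "AE w in M. N (rscale \<xi> x) w \<le> \<xi> w * N x w"
    if "\<xi> \<in> borel_measurable M" "\<And>w. 0 < \<xi> w" "x \<in> carrier E" for \<xi> x
    using N_rscale[OF that(1,3)] by eventually_elim (use that(2) in \<open>simp add: abs_of_pos\<close>)
  ultimately have "sublin (\<lambda>x\<in>carrier E. nrm x)"
    unfolding sublin_def using N_add
    by (auto simp: N_def rscale_closed)
  then show thesis by (rule that) (auto simp: N_def)
qed

text \<open>Zorn's lemma needs an antisymmetric order. Values are classes and functionals are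
  extensional, so mutual a.e. domination is equality. A chain is bounded by its pointwise essential
  infimum.\<close>

lemma sublin_minimal:
  assumes p0: "sublin p0"
  obtains p where "sublin p" "\<And>x. x \<in> carrier E \<Longrightarrow> AE w in M. L0_rep (p x) w \<le> L0_rep (p0 x) w"
    "\<And>q x. sublin q \<Longrightarrow> (\<And>x. x \<in> carrier E \<Longrightarrow> AE w in M. L0_rep (q x) w \<le> L0_rep (p x) w) \<Longrightarrow> q = p"
proof -
  \<comment> \<open>The order is reversed: \<open>P p q\<close> means that \<open>q\<close> lies
    below \<open>p\<close>, so a maximal element for \<open>P\<close> is a minimal
    functional.\<close>
  define P where "P p q \<longleftrightarrow> (\<forall>x\<in>carrier E. L0_le M (q x) (p x))" for p q :: "'e \<Rightarrow> ('w \<Rightarrow> real) set"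
  define A where "A = {p. sublin p \<and> P p0 p}"
  have refl: "P p p" for p by (simp add: P_def L0_le_def)
  have trans: "P p r" if "P p q" "P q r" for p q r
    unfolding P_def L0_le_def
  proof
    fix x assume "x \<in> carrier E"
    then have "AE w in M. L0_rep (q x) w \<le> L0_rep (p x) w" "AE w in M. L0_rep (r x) w \<le> L0_rep (q x) w"
      using that by (auto simp: P_def L0_le_def)
    then show "AE w in M. L0_rep (r x) w \<le> L0_rep (p x) w" by eventually_elim simp
  qed
  have anti: "p = q" if pq: "sublin p" "sublin q" "P p q" "P q p" for p q
  proof (rule extensionalityI)
    show "p \<in> extensional (carrier E)" "q \<in> extensional (carrier E)"
      using pq(1,2) by (auto simp: sublin_def PiE_def)
    fix x assume x: "x \<in> carrier E"
    then have "AE w in M. L0_rep (p x) w \<le> L0_rep (q x) w" "AE w in M. L0_rep (q x) w \<le> L0_rep (p x) w"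
      using pq(3,4) by (auto simp: P_def L0_le_def)
    then have "AE w in M. L0_rep (p x) w = L0_rep (q x) w" by eventually_elim simp
    then show "p x = q x" by (rule L0_eqI[OF sublin_in[OF pq(1) x] sublin_in[OF pq(2) x]])
  qed
  have po: "partial_order_on A (relation_of P A)"
    using refl trans anti unfolding partial_order_on_def preorder_on_def
    by (auto simp: refl_on_def relation_of_def trans_def antisym_def A_def)
  have "\<exists>u\<in>A. \<forall>a\<in>C. P a u" if C: "C \<in> Chains (relation_of P A)" for C
  proof (cases "C = {}")
    case True
    then show ?thesis using p0 refl by (auto simp: A_def)
  next
    case False
    have CA: "sublin p" "P p0 p" if "p \<in> C" for p
      using that C by (auto simp: Chains_def relation_of_def A_def)
    have tot: "P p q \<or> P q p" if "p \<in> C" "q \<in> C" for p q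
      using that C by (auto simp: Chains_def relation_of_def)
    define F where "F x = (\<lambda>p. L0_rep (p x)) ` C" for x
    have "\<exists>q. sublin q \<and> (\<forall>x\<in>carrier E. \<forall>u\<in>F x. AE w in M. L0_rep (q x) w \<le> u w)"
    proof (rule inf_sublin)
      fix x assume x: "x \<in> carrier E"
      show "F x \<subseteq> borel_measurable M" using CA sublin_measurable x by (auto simp: F_def)
      show "\<exists>t\<in>F x. AE w in M. t w \<le> N x w"
        using False CA sublin_le[OF _ x] unfolding F_def by blast
    next
      fix x u assume "x \<in> carrier E" "u \<in> F x"
      then show "AE w in M. - N x w \<le> u w" using CA sublin_ge by (auto simp: F_def)
    next
      fix x y u v assume x: "x \<in> carrier E" and y: "y \<in> carrier E" and "u \<in> F x" "v \<in> F y"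
      then obtain p q where pq: "p \<in> C" "q \<in> C" "u = L0_rep (p x)" "v = L0_rep (q y)"
        by (auto simp: F_def)
      \<comment> \<open>Two members of a chain have a smaller one \<open>r\<close> among them, which
        replaces both; this is why the infimum remains subadditive.\<close>
      obtain r where r: "r \<in> C" "P p r" "P q r" using tot[OF pq(1,2)] refl pq(1,2) by blast
      have "AE w in M. L0_rep (r x) w \<le> u w" "AE w in M. L0_rep (r y) w \<le> v w"
        using r x y pq by (auto simp: P_def L0_le_def)
      then have "AE w in M. L0_rep (r (x \<oplus>\<^bsub>E\<^esub> y)) w \<le> u w + v w"
        using sublin_add[OF CA(1)[OF r(1)] x y] by eventually_elim simp
      then show "\<exists>t\<in>F (x \<oplus>\<^bsub>E\<^esub> y). AE w in M. t w \<le> u w + v w" using r(1) unfolding F_def by blast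
    next
      fix x u and \<xi> :: "'w \<Rightarrow> real" assume x: "x \<in> carrier E" and "u \<in> F x" and \<xi>: "\<xi> \<in> borel_measurable M" "\<And>w. 0 < \<xi> w"
      then obtain p where p: "p \<in> C" "u = L0_rep (p x)" by (auto simp: F_def)
      have "AE w in M. L0_rep (p (rscale \<xi> x)) w \<le> \<xi> w * u w"
        unfolding p(2) by (rule sublin_rscale[OF CA(1)[OF p(1)] \<xi> x])
      then show "\<exists>t\<in>F (rscale \<xi> x). AE w in M. t w \<le> \<xi> w * u w" using p(1) unfolding F_def by blast
    qed
    then obtain q where q: "sublin q" "\<And>x p. x \<in> carrier E \<Longrightarrow> p \<in> C \<Longrightarrow> AE w in M. L0_rep (q x) w \<le> L0_rep (p x) w"
      unfolding F_def by auto
    have "P p q" if "p \<in> C" for p using q(2) that by (simp add: P_def L0_le_def)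
    moreover from this False CA(2) trans have "P p0 q" by blast
    ultimately show ?thesis using q(1) by (auto simp: A_def)
  qed
  from predicate_Zorn[OF po this] obtain p where p: "p \<in> A" "\<forall>a\<in>A. P p a \<longrightarrow> a = p" by blast
  show thesis
  proof (rule that)
    show "AE w in M. L0_rep (p x) w \<le> L0_rep (p0 x) w" if "x \<in> carrier E" for x
      using p(1) that by (auto simp: A_def P_def L0_le_def)
    fix q assume q: "sublin q" "\<And>x. x \<in> carrier E \<Longrightarrow> AE w in M. L0_rep (q x) w \<le> L0_rep (p x) w"
    then have "P p q" by (simp add: P_def L0_le_def)
    moreover from this have "q \<in> A" using q(1) p(1) trans by (auto simp: A_def)
    ultimately show "q = p" using p(2) by blast
  qed (use p(1) in \<open>simp add: A_def\<close>)
qed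

text \<open>The norm is lowered at \<open>x0\<close> before a minimal functional p is chosen below
  the result p0. Then N(x0) \<le> -p0(-x0) \<le> -p(-x0) \<le> p(x0) \<le> N(x0), so the norm is
  attained at \<open>x0\<close>, while minimality alone makes p linear.\<close>

lemma random_Hahn_Banach:
  assumes x0: "x0 \<in> carrier E"
  obtains g :: "'e \<Rightarrow> 'w \<Rightarrow> real" where
    "\<And>x. x \<in> carrier E \<Longrightarrow> g x \<in> borel_measurable M"
    "\<And>x y. x \<in> carrier E \<Longrightarrow> y \<in> carrier E \<Longrightarrow> AE w in M. g (x \<oplus>\<^bsub>E\<^esub> y) w = g x w + g y w"
    "\<And>\<xi> x. \<xi> \<in> borel_measurable M \<Longrightarrow> x \<in> carrier E \<Longrightarrow> AE w in M. g (rscale \<xi> x) w = \<xi> w * g x w"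
    "\<And>x. x \<in> carrier E \<Longrightarrow> AE w in M. \<bar>g x w\<bar> \<le> N x w"
    "AE w in M. g x0 w = N x0 w"
proof -
  obtain n where n: "sublin n" "\<And>x. x \<in> carrier E \<Longrightarrow> AE w in M. L0_rep (n x) w = N x w"
    using N_sublin by blast
  obtain p0 where p0: "sublin p0" "\<And>x. x \<in> carrier E \<Longrightarrow> AE w in M. L0_rep (p0 x) w \<le> L0_rep (n x) w"
    "AE w in M. L0_rep (p0 (neg x0)) w \<le> - L0_rep (n x0) w"
    using sublin_reduce[OF n(1) x0] by blast
  obtain p where p: "sublin p" "\<And>x. x \<in> carrier E \<Longrightarrow> AE w in M. L0_rep (p x) w \<le> L0_rep (p0 x) w"
    and min: "\<And>q x. sublin q \<Longrightarrow> (\<And>x. x \<in> carrier E \<Longrightarrow> AE w in M. L0_rep (q x) w \<le> L0_rep (p x) w) \<Longrightarrow> q = p"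
    using sublin_minimal[OF p0(1)] by blast
  have neg_le: "AE w in M. L0_rep (p (neg y)) w \<le> - L0_rep (p y) w" if y: "y \<in> carrier E" for y
  proof -
    obtain q where q: "sublin q" "\<And>x. x \<in> carrier E \<Longrightarrow> AE w in M. L0_rep (q x) w \<le> L0_rep (p x) w"
      "AE w in M. L0_rep (q (neg y)) w \<le> - L0_rep (p y) w"
      using sublin_reduce[OF p(1) y] by blast
    with min[OF q(1,2)] show ?thesis by simp
  qed
  have add: "AE w in M. L0_rep (p (x \<oplus>\<^bsub>E\<^esub> y)) w = L0_rep (p x) w + L0_rep (p y) w"
    if x: "x \<in> carrier E" and y: "y \<in> carrier E" for x y
  proof -
    have c: "x \<oplus>\<^bsub>E\<^esub> y \<in> carrier E" using x y by simp
    \<comment> \<open>Superadditivity: p(x) \<le> p(x + y) + p(-y) \<le> p(x + y) - p(y).\<close>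
    have "(x \<oplus>\<^bsub>E\<^esub> y) \<oplus>\<^bsub>E\<^esub> neg y = x"
      using x y neg_closed[OF y] by (simp add: E.M.a_assoc add_neg)
    then have "AE w in M. L0_rep (p x) w \<le> L0_rep (p (x \<oplus>\<^bsub>E\<^esub> y)) w + L0_rep (p (neg y)) w"
      using sublin_add[OF p(1) c neg_closed[OF y]] by simp
    with neg_le[OF y] sublin_add[OF p(1) x y] show ?thesis by eventually_elim simp
  qed
  have pos: "AE w in M. L0_rep (p (rscale \<xi> x)) w = \<xi> w * L0_rep (p x) w"
    if \<xi> [measurable]: "\<xi> \<in> borel_measurable M" and gt: "\<And>w. 0 < \<xi> w" and x: "x \<in> carrier E" for \<xi> x
  proof -
    have c: "rscale \<xi> x \<in> carrier E" by (rule rscale_closed[OF \<xi> x])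
    have "rscale (\<lambda>w. 1 / \<xi> w) (rscale \<xi> x) = rscale (\<lambda>w. 1 / \<xi> w * \<xi> w) x"
      by (rule rscale_rscale) (use x in auto)
    also have "(\<lambda>w. 1 / \<xi> w * \<xi> w) = (\<lambda>w. 1)" using gt by (auto simp: less_imp_neq[symmetric])
    finally have inv: "rscale (\<lambda>w. 1 / \<xi> w) (rscale \<xi> x) = x" using x by (simp add: rscale_one)
    have "AE w in M. L0_rep (p (rscale (\<lambda>w. 1 / \<xi> w) (rscale \<xi> x))) w \<le> 1 / \<xi> w * L0_rep (p (rscale \<xi> x)) w"
      by (rule sublin_rscale[OF p(1) _ _ c]) (use gt in auto)
    with sublin_rscale[OF p(1) \<xi> gt x] show ?thesis
      unfolding inv
    proof eventually_elim
      case (elim w)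
      then show ?case using gt[of w] by (simp add: le_divide_eq mult.commute)
    qed
  qed
  show thesis
  proof (rule that[of "\<lambda>x. L0_rep (p x)"])
    fix x assume x: "x \<in> carrier E"
    show "L0_rep (p x) \<in> borel_measurable M" by (rule sublin_measurable[OF p(1) x])
    show "AE w in M. \<bar>L0_rep (p x) w\<bar> \<le> N x w"
      using sublin_le[OF p(1) x] sublin_ge[OF p(1) x] by eventually_elim auto
    fix y assume "y \<in> carrier E"
    with x show "AE w in M. L0_rep (p (x \<oplus>\<^bsub>E\<^esub> y)) w = L0_rep (p x) w + L0_rep (p y) w" by (rule add)
  next
    fix \<xi> :: "'w \<Rightarrow> real" and x assume \<xi> [measurable]: "\<xi> \<in> borel_measurable M" and x: "x \<in> carrier E"
    \<comment> \<open>Any real \<xi> is a difference of strictly positive functions a and b. The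
      summand 1 makes them strictly positive, as the homogeneity already shown requires.\<close>
    define a b where "a w = max (\<xi> w) 0 + 1" and "b w = max (- \<xi> w) 0 + 1" for w
    have [measurable]: "a \<in> borel_measurable M" "b \<in> borel_measurable M" unfolding a_def b_def by measurable
    have gt: "0 < a w" "0 < b w" and ab: "a w = \<xi> w + b w" for w by (auto simp: a_def b_def)
    have c: "rscale \<xi> x \<in> carrier E" "rscale b x \<in> carrier E"
      by (rule rscale_closed; use x in auto)+
    have "rscale a x = rscale \<xi> x \<oplus>\<^bsub>E\<^esub> rscale b x"
      unfolding ab by (rule rscale_add_left) (use x in auto)
    with add[OF c] have "AE w in M. L0_rep (p (rscale a x)) w = L0_rep (p (rscale \<xi> x)) w + L0_rep (p (rscale b x)) w"
      by simp
    moreover have "AE w in M. L0_rep (p (rscale a x)) w = a w * L0_rep (p x) w"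
      "AE w in M. L0_rep (p (rscale b x)) w = b w * L0_rep (p x) w"
      by (rule pos; use gt x in auto)+
    ultimately show "AE w in M. L0_rep (p (rscale \<xi> x)) w = \<xi> w * L0_rep (p x) w"
      by eventually_elim (simp add: ab algebra_simps)
  next
    show "AE w in M. L0_rep (p x0) w = N x0 w"
      using sublin_le[OF p(1) x0] sublin_neg[OF p(1) x0] p0(3) p(2)[OF neg_closed[OF x0]] n(2)[OF x0]
      by eventually_elim simp
  qed
qed

section \<open>Non-compactness of the dual unit ball\<close>

text \<open>Elements of the dual ball described by chosen measurable functions, with all laws
  holding a.e.; restriction to an event is then multiplication by its indicator.\<close>

definition contraction :: "('e \<Rightarrow> 'w \<Rightarrow> 'k) \<Rightarrow> bool" where
  "contraction f \<longleftrightarrow>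
    (\<forall>x\<in>carrier E. f x \<in> borel_measurable M \<and> (AE w in M. norm (f x w) \<le> N x w)) \<and>
    (\<forall>x\<in>carrier E. \<forall>y\<in>carrier E. AE w in M. f (x \<oplus>\<^bsub>E\<^esub> y) w = f x w + f y w) \<and>
    (\<forall>\<xi>\<in>borel_measurable M. \<forall>x\<in>carrier E. AE w in M. f (scale \<xi> x) w = \<xi> w * f x w)"

definition dual_of :: "('e \<Rightarrow> 'w \<Rightarrow> 'k) \<Rightarrow> 'e \<Rightarrow> ('w \<Rightarrow> 'k) set" where
  "dual_of f = (\<lambda>x\<in>carrier E. L0_class M (f x))"

lemma dual_of_rep:
  assumes "contraction f" "x \<in> carrier E"
  shows "dual_of f x \<in> L0 M" "AE w in M. L0_rep (dual_of f x) w = f x w"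
  using assms by (auto simp: dual_of_def contraction_def intro: L0_class_in L0_rep_class(2))

text \<open>The constant 1 is one of the admissible bounds, and the dual norm is their
  infimum.\<close>

lemma contraction_in_ball:
  assumes f: "contraction f"
  shows "dual_of f \<in> dual_unit_ball M E nrm"
proof -
  interpret R: cring "L0_ring M :: ('w \<Rightarrow> 'k) set ring" by (rule cring_L0_ring)
  note closed = R.add.m_closed[unfolded carrier_L0_ring] R.m_closed[unfolded carrier_L0_ring]
  note rep = dual_of_rep[OF f]
  define one where "one = L0_class M (\<lambda>w. 1 :: real)"
  have one: "one \<in> L0 M" "AE w in M. L0_rep one w = 1"
    unfolding one_def by (auto intro: L0_class_in L0_rep_class(2))
  have zero: "AE w in M. L0_rep (L0_class M (\<lambda>w. 0)) w = (0::real)"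
    by (rule L0_rep_class(2)) simp
  have "L0_le M (L0_class M (\<lambda>w. 0)) one"
    unfolding L0_le_def using one(2) zero by eventually_elim simp
  moreover have "L0_le M (L0_abs M (dual_of f x)) (one \<otimes>\<^bsub>L0_ring M\<^esub> nrm x)" if x: "x \<in> carrier E" for x
  proof -
    have "AE w in M. norm (f x w) \<le> N x w" using f x by (auto simp: contraction_def)
    with one(2) L0_rep_mult[OF one(1) nrm_in[OF x]] L0_rep_abs[OF rep(1)[OF x]] rep(2)[OF x]
    show ?thesis unfolding L0_le_def N_def by eventually_elim simp
  qed
  ultimately have one_bound: "one \<in> dual_bounds M E nrm (dual_of f)"
    by (simp add: dual_bounds_def L0_plus_def one(1))
  have dual: "dual_of f \<in> random_dual M E nrm"
    unfolding random_dual_def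
  proof (intro CollectI conjI ballI)
    show "dual_of f \<in> carrier E \<rightarrow>\<^sub>E L0 M" using rep(1) by (auto simp: dual_of_def)
    show "dual_bounds M E nrm (dual_of f) \<noteq> {}" using one_bound by blast
  next
    fix x y assume x: "x \<in> carrier E" and y: "y \<in> carrier E"
    have xy: "x \<oplus>\<^bsub>E\<^esub> y \<in> carrier E" using x y by simp
    have "AE w in M. f (x \<oplus>\<^bsub>E\<^esub> y) w = f x w + f y w" using f x y by (simp add: contraction_def)
    with rep(2)[OF x] rep(2)[OF y] rep(2)[OF xy] L0_rep_add[OF rep(1)[OF x] rep(1)[OF y]]
    have "AE w in M. L0_rep (dual_of f (x \<oplus>\<^bsub>E\<^esub> y)) w = L0_rep (dual_of f x \<oplus>\<^bsub>L0_ring M\<^esub> dual_of f y) w"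
      by eventually_elim simp
    then show "dual_of f (x \<oplus>\<^bsub>E\<^esub> y) = dual_of f x \<oplus>\<^bsub>L0_ring M\<^esub> dual_of f y"
      by (rule L0_eqI[OF rep(1)[OF xy] closed(1)[OF rep(1)[OF x] rep(1)[OF y]]])
  next
    fix \<xi> :: "('w \<Rightarrow> 'k) set" and x assume \<xi>: "\<xi> \<in> L0 M" and x: "x \<in> carrier E"
    have eq: "\<xi> \<odot>\<^bsub>E\<^esub> x = scale (L0_rep \<xi>) x"
      by (simp add: scale_def L0_rep_L0(2)[OF \<xi>])
    have c: "scale (L0_rep \<xi>) x \<in> carrier E" using L0_rep_L0(1)[OF \<xi>] x by simp
    have "AE w in M. f (scale (L0_rep \<xi>) x) w = L0_rep \<xi> w * f x w"
      using f x L0_rep_L0(1)[OF \<xi>] by (simp add: contraction_def)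
    with rep(2)[OF x] rep(2)[OF c] L0_rep_mult[OF \<xi> rep(1)[OF x]]
    have "AE w in M. L0_rep (dual_of f (scale (L0_rep \<xi>) x)) w = L0_rep (\<xi> \<otimes>\<^bsub>L0_ring M\<^esub> dual_of f x) w"
      by eventually_elim simp
    then show "dual_of f (\<xi> \<odot>\<^bsub>E\<^esub> x) = \<xi> \<otimes>\<^bsub>L0_ring M\<^esub> dual_of f x"
      unfolding eq by (rule L0_eqI[OF rep(1)[OF c] closed(2)[OF \<xi> rep(1)[OF x]]])
  qed
  have ereal_in: "L0_ereal M X \<in> L0 M" if "X \<in> L0 M" for X
    unfolding L0_ereal_def using L0_rep_L0(1)[OF that] by (intro L0_class_in) simp
  have bounds: "L0_ereal M ` dual_bounds M E nrm (dual_of f) \<subseteq> L0 M"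
    using ereal_in by (auto simp: dual_bounds_def L0_plus_def)
  have "dual_norm M E nrm (dual_of f) \<in> Lower (L0_ereal_lattice M) (L0_ereal M ` dual_bounds M E nrm (dual_of f))"
    using greatest_L0_inf[OF finite_measure_axioms bounds] unfolding dual_norm_def greatest_def by blast
  then have "L0_le M (dual_norm M E nrm (dual_of f)) (L0_ereal M one)"
    using one_bound ereal_in[OF one(1)] by (auto simp: Lower_def L0_ereal_lattice_def)
  moreover have "L0_ereal M one = L0_class M (\<lambda>w. 1)"
    unfolding L0_ereal_def
  proof (rule L0_class_eqI)
    show "AE w in M. ereal (L0_rep one w) = 1" using one(2) by eventually_elim simp
  qed
  ultimately show ?thesis using dual by (simp add: dual_unit_ball_def)
qed

lemma contraction_indicator:
  assumes f: "contraction f" and A: "A \<in> sets M"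
  shows "contraction (\<lambda>x w. indicator A w * f x w)"
  unfolding contraction_def
proof (intro conjI ballI)
  fix x assume x: "x \<in> carrier E"
  then have [measurable]: "f x \<in> borel_measurable M" using f by (simp add: contraction_def)
  show "(\<lambda>w. indicator A w * f x w) \<in> borel_measurable M" using A by measurable
  have "AE w in M. norm (f x w) \<le> N x w" using f x by (simp add: contraction_def)
  with N_nonneg[OF x] show "AE w in M. norm (indicator A w * f x w) \<le> N x w"
    by eventually_elim (simp add: indicator_def)
  fix y assume y: "y \<in> carrier E"
  have "AE w in M. f (x \<oplus>\<^bsub>E\<^esub> y) w = f x w + f y w" using f x y by (simp add: contraction_def)
  then show "AE w in M. indicator A w * f (x \<oplus>\<^bsub>E\<^esub> y) w = indicator A w * f x w + indicator A w * f y w"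
    by eventually_elim (simp add: algebra_simps)
next
  fix \<xi> :: "'w \<Rightarrow> 'k" and x assume "\<xi> \<in> borel_measurable M" "x \<in> carrier E"
  then have "AE w in M. f (scale \<xi> x) w = \<xi> w * f x w" using f by (simp add: contraction_def)
  then show "AE w in M. indicator A w * f (scale \<xi> x) w = \<xi> w * (indicator A w * f x w)"
    by eventually_elim simp
qed

lemma dual_unit_ball_not_compact:
  fixes B :: "nat \<Rightarrow> 'w set"
  assumes x0: "x0 \<in> carrier E" and f: "contraction f"
    and B: "\<And>n. B n \<in> sets M" "\<And>n. measure M (B n) > 0" "disjoint_family B"
    and ne: "\<And>n. AE w in M. w \<in> B n \<longrightarrow> f x0 w \<noteq> 0"
  shows "\<not> compactin (sigma_c M E nrm) (dual_unit_ball M E nrm)"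
proof
  let ?K = "dual_unit_ball M E nrm"
  assume comp: "compactin (sigma_c M E nrm) ?K"
  have [measurable]: "f x0 \<in> borel_measurable M" using f x0 by (simp add: contraction_def)
  \<comment> \<open>One third leaves room for two errors and a strict contradiction. The value 1
    where \<open>f x0\<close> vanishes keeps the radius strictly positive everywhere, as a radius in
    \<open>L0_pos\<close> must be.\<close>
  define \<delta> where "\<delta> w = (if f x0 w = 0 then 1 else norm (f x0 w) / 3)" for w
  have \<delta>_meas [measurable]: "\<delta> \<in> borel_measurable M" unfolding \<delta>_def by measurable
  have \<delta>_pos: "\<delta> w > 0" for w by (simp add: \<delta>_def)
  \<comment> \<open>The constant \<open>r\<close> below 1 makes \<open>G h\<close> open: around an
    element with constant \<open>r\<close>, the radius (1 - r)/2 times \<open>\<delta>\<close> leads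
    to the constant (1 + r)/2, which is again below 1.\<close>
  define G where "G h = {g \<in> random_dual M E nrm.
    \<exists>r<1. AE w in M. norm (L0_rep (g x0) w - L0_rep (h x0) w) \<le> r * \<delta> w}" for h
  have in_L0: "g x0 \<in> L0 M" if "g \<in> random_dual M E nrm" for g
    using that x0 by (auto simp: random_dual_def)
  have K_dual: "?K \<subseteq> random_dual M E nrm" by (auto simp: dual_unit_ball_def)
  have "sigma_c_open M E nrm (G h)" for h
    unfolding sigma_c_open_def
  proof (intro conjI ballI)
    show "G h \<subseteq> random_dual M E nrm" by (auto simp: G_def)
    fix g assume "g \<in> G h"
    then obtain r where g: "g \<in> random_dual M E nrm" and r: "r < 1"
      and gh: "AE w in M. norm (L0_rep (g x0) w - L0_rep (h x0) w) \<le> r * \<delta> w"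
      by (auto simp: G_def)
    define \<epsilon> where "\<epsilon> = L0_class M (\<lambda>w. (1 - r) / 2 * \<delta> w)"
    have "(\<lambda>w. (1 - r) / 2 * \<delta> w) \<in> borel_measurable M" by measurable
    then have \<epsilon>: "\<epsilon> \<in> L0 M" "AE w in M. L0_rep \<epsilon> w = (1 - r) / 2 * \<delta> w"
      unfolding \<epsilon>_def by (rule L0_class_in, rule L0_rep_class(2))
    have zero: "AE w in M. L0_rep (L0_class M (\<lambda>w. 0)) w = (0::real)"
      by (rule L0_rep_class(2)) simp
    have pos: "AE w in M. 0 < L0_rep \<epsilon> w"
      using \<epsilon>(2)
    proof eventually_elim
      case (elim w)
      have "0 < (1 - r) / 2 * \<delta> w" using r \<delta>_pos[of w] by simp
      then show ?case by (simp only: elim)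
    qed
    with zero have "AE w in M. L0_rep (L0_class M (\<lambda>w. 0)) w \<le> L0_rep \<epsilon> w"
      by eventually_elim simp
    then have "\<epsilon> \<in> L0_pos M" using \<epsilon>(1) pos by (simp add: L0_pos_def L0_plus_def L0_le_def)
    moreover have "sigma_c_nbhd M E nrm g {x0} \<epsilon> \<subseteq> G h"
    proof
      fix g' assume "g' \<in> sigma_c_nbhd M E nrm g {x0} \<epsilon>"
      then have g': "g' \<in> random_dual M E nrm"
        and le: "L0_le M (L0_abs M (g' x0 \<ominus>\<^bsub>L0_ring M\<^esub> g x0)) \<epsilon>"
        by (auto simp: sigma_c_nbhd_def)
      interpret R: cring "L0_ring M :: ('w \<Rightarrow> 'k) set ring" by (rule cring_L0_ring)
      have c: "g' x0 \<ominus>\<^bsub>L0_ring M\<^esub> g x0 \<in> L0 M"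
        using R.minus_closed[unfolded carrier_L0_ring, OF in_L0[OF g'] in_L0[OF g]] .
      have "AE w in M. norm (L0_rep (g' x0) w - L0_rep (h x0) w) \<le> (1 + r) / 2 * \<delta> w"
        using le[unfolded L0_le_def] L0_rep_abs[OF c] L0_rep_minus[OF in_L0[OF g'] in_L0[OF g]] gh \<epsilon>(2)
      proof eventually_elim
        case (elim w)
        have "norm (L0_rep (g' x0) w - L0_rep (h x0) w) \<le>
          norm (L0_rep (g' x0) w - L0_rep (g x0) w) + norm (L0_rep (g x0) w - L0_rep (h x0) w)"
          using norm_triangle_ineq[of "L0_rep (g' x0) w - L0_rep (g x0) w" "L0_rep (g x0) w - L0_rep (h x0) w"]
          by simp
        also have "\<dots> \<le> (1 - r) / 2 * \<delta> w + r * \<delta> w" using elim by simp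
        also have "\<dots> = (1 + r) / 2 * \<delta> w" by (simp add: field_simps)
        finally show ?case .
      qed
      moreover have "(1 + r) / 2 < 1" using r by simp
      ultimately show "g' \<in> G h" using g' unfolding G_def by blast
    qed
    ultimately show "\<exists>X \<epsilon>. finite X \<and> X \<subseteq> carrier E \<and> \<epsilon> \<in> L0_pos M \<and> sigma_c_nbhd M E nrm g X \<epsilon> \<subseteq> G h"
      using x0 by (intro exI[of _ "{x0}"] exI[of _ \<epsilon>]) simp
  qed
  then have opn: "\<forall>U\<in>G ` ?K. openin (sigma_c M E nrm) U" by (simp add: openin_sigma_c)
  have "h \<in> G h" if "h \<in> ?K" for h
    using that K_dual by (auto simp: G_def intro!: exI[of _ 0])
  then have "?K \<subseteq> \<Union>(G ` ?K)" by blast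
  then obtain \<F> where \<F>: "finite \<F>" "\<F> \<subseteq> G ` ?K" "?K \<subseteq> \<Union>\<F>"
    using comp opn unfolding compactin_def by (metis (no_types, lifting))
  define h where "h n = dual_of (\<lambda>x w. indicator (B n) w * f x w)" for n
  have hc: "contraction (\<lambda>x w. indicator (B n) w * f x w)" for n
    by (rule contraction_indicator[OF f B(1)])
  have hK: "h n \<in> ?K" for n unfolding h_def by (rule contraction_in_ball[OF hc])
  have h_rep: "AE w in M. L0_rep (h n x0) w = indicator (B n) w * f x0 w" for n
    unfolding h_def by (rule dual_of_rep(2)[OF hc x0])
  have "\<forall>n. \<exists>U\<in>\<F>. h n \<in> U" using hK \<F>(3) by blast
  then obtain c where c: "\<And>n. c n \<in> \<F>" "\<And>n. h n \<in> c n" by metis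
  \<comment> \<open>Pigeonhole: two of the infinitely many functionals \<open>h n\<close> lie in the
    same set of the finite subcover.\<close>
  have "finite (range c)" using c(1) \<F>(1) by (meson finite_subset image_subset_iff)
  then have "\<not> inj c" using finite_imageD infinite_UNIV_nat by blast
  then obtain m n where mn: "m \<noteq> n" "c m = c n" by (auto simp: inj_def)
  obtain k where k: "c m = G k" using c(1)[of m] \<F>(2) by blast
  have "h m \<in> G k" "h n \<in> G k" using c(2)[of m] c(2)[of n] mn(2) k by auto
  then obtain r s where rs: "r < 1" "s < 1"
    "AE w in M. norm (L0_rep (h m x0) w - L0_rep (k x0) w) \<le> r * \<delta> w"
    "AE w in M. norm (L0_rep (h n x0) w - L0_rep (k x0) w) \<le> s * \<delta> w"
    by (auto simp: G_def)
  \<comment> \<open>On \<open>B m\<close> the two functionals take the values \<open>f x0\<close>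
    and 0 at \<open>x0\<close>. Being both close to \<open>k\<close>, they would force the norm of
    \<open>f x0\<close> to be at most two thirds of itself, although it is a.e. nonzero
    there.\<close>
  have "AE w in M. w \<notin> B m"
    using rs(3,4) h_rep[of m] h_rep[of n] ne[of m]
  proof eventually_elim
    case (elim w)
    show ?case
    proof
      assume w: "w \<in> B m"
      then have "w \<notin> B n" using B(3) mn(1) by (auto simp: disjoint_family_on_def)
      then have "norm (f x0 w) = norm (L0_rep (h m x0) w - L0_rep (h n x0) w)"
        using elim(3,4) w by simp
      also have "\<dots> \<le> norm (L0_rep (h m x0) w - L0_rep (k x0) w) + norm (L0_rep (h n x0) w - L0_rep (k x0) w)"
        using norm_triangle_ineq4[of "L0_rep (h m x0) w - L0_rep (k x0) w" "L0_rep (h n x0) w - L0_rep (k x0) w"]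
        by simp
      also have "\<dots> \<le> r * \<delta> w + s * \<delta> w" using elim(1,2) by simp
      also have "\<dots> \<le> 1 * \<delta> w + 1 * \<delta> w"
        by (intro add_mono mult_right_mono) (use rs(1,2) \<delta>_pos[of w] in auto)
      finally show False using elim(5) w by (simp add: \<delta>_def)
    qed
  qed
  then have "measure M (B m) = 0"
    using AE_iff_null_sets[OF B(1)[of m]] by (simp add: null_sets_def measure_def)
  then show False using B(2)[of m] by simp
qed

text \<open>The only consequence of Hahn--Banach used later. It isolates the point where real and
  complex scalars require different proofs.\<close>

definition norming :: bool where
  "norming \<longleftrightarrow> (\<forall>x\<in>carrier E. \<exists>f. contraction f \<and> (AE w in M. N x w \<noteq> 0 \<longrightarrow> f x w \<noteq> 0))"

end

lemma norming_real:
  fixes E :: "(('w \<Rightarrow> real) set, 'e, 'm) module_scheme"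
  assumes "rn_module M E nrm"
  shows "rn_module.norming M E nrm"
proof -
  interpret rn_module M E nrm by fact
  show ?thesis
    unfolding norming_def
  proof
    fix x0 assume x0: "x0 \<in> carrier E"
    obtain g where g: "\<And>x. x \<in> carrier E \<Longrightarrow> g x \<in> borel_measurable M"
      "\<And>x y. x \<in> carrier E \<Longrightarrow> y \<in> carrier E \<Longrightarrow> AE w in M. g (x \<oplus>\<^bsub>E\<^esub> y) w = g x w + g y w"
      "\<And>\<xi> x. \<xi> \<in> borel_measurable M \<Longrightarrow> x \<in> carrier E \<Longrightarrow> AE w in M. g (rscale \<xi> x) w = \<xi> w * g x w"
      "\<And>x. x \<in> carrier E \<Longrightarrow> AE w in M. \<bar>g x w\<bar> \<le> N x w"
      "AE w in M. g x0 w = N x0 w"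
      using random_Hahn_Banach[OF x0] by blast
    have "rscale \<xi> = scale \<xi>" for \<xi> by (simp add: rscale_def)
    with g have "contraction g" by (simp add: contraction_def)
    moreover have "AE w in M. N x0 w \<noteq> 0 \<longrightarrow> g x0 w \<noteq> 0" using g(5) by eventually_elim simp
    ultimately show "\<exists>f. contraction f \<and> (AE w in M. N x0 w \<noteq> 0 \<longrightarrow> f x0 w \<noteq> 0)" by blast
  qed
qed

text \<open>The complexification \<open>g x - \<i> g (\<i> x)\<close> is halved so that the crude bound by the sum of both
  parts suffices.\<close>

lemma norming_complex:
  fixes E :: "(('w \<Rightarrow> complex) set, 'e, 'm) module_scheme"
  assumes "rn_module M E nrm"
  shows "rn_module.norming M E nrm"
proof -
  interpret rn_module M E nrm by fact
  show ?thesis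
    unfolding norming_def
  proof
    fix x0 assume x0: "x0 \<in> carrier E"
    obtain g where g: "\<And>x. x \<in> carrier E \<Longrightarrow> g x \<in> borel_measurable M"
      "\<And>x y. x \<in> carrier E \<Longrightarrow> y \<in> carrier E \<Longrightarrow> AE w in M. g (x \<oplus>\<^bsub>E\<^esub> y) w = g x w + g y w"
      "\<And>\<xi> x. \<xi> \<in> borel_measurable M \<Longrightarrow> x \<in> carrier E \<Longrightarrow> AE w in M. g (rscale \<xi> x) w = \<xi> w * g x w"
      "\<And>x. x \<in> carrier E \<Longrightarrow> AE w in M. \<bar>g x w\<bar> \<le> N x w"
      "AE w in M. g x0 w = N x0 w"
      using random_Hahn_Banach[OF x0] by blast
    define I where "I = scale (\<lambda>w. \<i>)"
    have I: "I x \<in> carrier E" if "x \<in> carrier E" for x using that by (simp add: I_def)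
    define f where "f x w = (complex_of_real (g x w) - \<i> * complex_of_real (g (I x) w)) / 2" for x w
    \<comment> \<open>\<open>g\<close> is homogeneous only for real scalars, so \<xi> x is split
      into (Re \<xi>) x + (Im \<xi>) (\<i> x). Used for \<xi> and for \<i> \<xi>, this yields
      complex homogeneity of \<open>f\<close>.\<close>
    have comb: "AE w in M. g (scale \<xi> x) w = Re (\<xi> w) * g x w + Im (\<xi> w) * g (I x) w"
      if \<xi> [measurable]: "\<xi> \<in> borel_measurable M" and x: "x \<in> carrier E" for \<xi> x
    proof -
      define a b where "a w = Re (\<xi> w)" and "b w = Im (\<xi> w)" for w
      have [measurable]: "a \<in> borel_measurable M" "b \<in> borel_measurable M"
        unfolding a_def b_def by measurable
      have "scale \<xi> x = scale (\<lambda>w. complex_of_real (a w) + complex_of_real (b w) * \<i>) x"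
        by (intro arg_cong2[where f = scale] ext refl) (simp add: a_def b_def complex_eq_iff)
      also have "\<dots> = rscale a x \<oplus>\<^bsub>E\<^esub> scale (\<lambda>w. complex_of_real (b w) * \<i>) x"
        unfolding rscale_def by (rule scale_add_left) (use x in measurable)
      also have "scale (\<lambda>w. complex_of_real (b w) * \<i>) x = rscale b (I x)"
        unfolding rscale_def I_def by (rule scale_scale[symmetric]) (use x in measurable)
      finally have eq: "scale \<xi> x = rscale a x \<oplus>\<^bsub>E\<^esub> rscale b (I x)" .
      have "AE w in M. g (rscale a x) w = a w * g x w" "AE w in M. g (rscale b (I x)) w = b w * g (I x) w"
        by (rule g(3); use x I in simp)+
      moreover have "AE w in M. g (rscale a x \<oplus>\<^bsub>E\<^esub> rscale b (I x)) w = g (rscale a x) w + g (rscale b (I x)) w"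
        by (rule g(2)) (use x I in auto)
      ultimately show ?thesis unfolding eq by eventually_elim (simp add: a_def b_def)
    qed
    have "contraction f"
      unfolding contraction_def
    proof (intro conjI ballI)
      fix x assume x: "x \<in> carrier E"
      have [measurable]: "g x \<in> borel_measurable M" "g (I x) \<in> borel_measurable M" using g(1) x I by auto
      show "f x \<in> borel_measurable M" unfolding f_def by measurable
      have "AE w in M. N (I x) w = norm \<i> * N x w" unfolding I_def by (rule N_scale) (use x in auto)
      with g(4)[OF x] g(4)[OF I[OF x]] show "AE w in M. norm (f x w) \<le> N x w"
      proof eventually_elim
        case (elim w)
        have "norm (f x w) \<le> (norm (complex_of_real (g x w)) + norm (\<i> * complex_of_real (g (I x) w))) / 2"
          unfolding f_def norm_divide
          using norm_triangle_ineq4[of "complex_of_real (g x w)" "\<i> * complex_of_real (g (I x) w)"]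
          by (simp add: divide_right_mono)
        also have "\<dots> \<le> N x w" using elim by (simp add: norm_mult)
        finally show ?case .
      qed
      fix y assume y: "y \<in> carrier E"
      have "I (x \<oplus>\<^bsub>E\<^esub> y) = I x \<oplus>\<^bsub>E\<^esub> I y" unfolding I_def by (rule scale_add_right) (use x y in auto)
      with g(2)[OF x y] g(2)[OF I[OF x] I[OF y]] show "AE w in M. f (x \<oplus>\<^bsub>E\<^esub> y) w = f x w + f y w"
        unfolding f_def by (auto elim!: eventually_elim2 simp: field_simps)
    next
      fix \<xi> :: "'w \<Rightarrow> complex" and x assume \<xi> [measurable]: "\<xi> \<in> borel_measurable M" and x: "x \<in> carrier E"
      have eq: "I (scale \<xi> x) = scale (\<lambda>w. \<i> * \<xi> w) x"
        unfolding I_def by (rule scale_scale) (use x in auto)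
      have "AE w in M. g (I (scale \<xi> x)) w = Re (\<i> * \<xi> w) * g x w + Im (\<i> * \<xi> w) * g (I x) w"
        unfolding eq by (rule comb) (use x in auto)
      with comb[OF \<xi> x] show "AE w in M. f (scale \<xi> x) w = \<xi> w * f x w"
        by eventually_elim (simp add: f_def complex_eq_iff field_simps)
    qed
    \<comment> \<open>The real part of \<open>f x0\<close> is half of \<open>g x0\<close>, hence
      half the norm of \<open>x0\<close>; halving does not affect where it vanishes.\<close>
    moreover have "AE w in M. N x0 w \<noteq> 0 \<longrightarrow> f x0 w \<noteq> 0"
      using g(5) by eventually_elim (auto simp: f_def complex_eq_iff)
    ultimately show "\<exists>f. contraction f \<and> (AE w in M. N x0 w \<noteq> 0 \<longrightarrow> f x0 w \<noteq> 0)" by blast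
  qed
qed

section \<open>Atoms\<close>

lemma (in finite_measure) P_atom_subset:
  assumes A: "P_atom M A" and B: "B \<in> sets M" "B \<subseteq> A" "measure M B > 0"
  shows "P_atom M B"
  unfolding P_atom_def
proof (intro conjI ballI impI)
  fix S assume S: "S \<in> sets M" "S \<subseteq> B"
  then have "measure M S = 0 \<or> measure M (A - S) = 0" using A B(2) by (auto simp: P_atom_def)
  moreover have "measure M (B - S) \<le> measure M (A - S)"
    using A B S by (intro finite_measure_mono) (auto simp: P_atom_def)
  ultimately show "measure M S = 0 \<or> measure M (B - S) = 0"
    using measure_nonneg[of M "B - S"] by linarith
qed (use B in auto)

lemma (in finite_measure) P_atom_Un_null:
  assumes A: "P_atom M A" and N: "N \<in> sets M" "measure M N = 0"
  shows "P_atom M (A \<union> N)"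
  unfolding P_atom_def
proof (intro conjI ballI impI)
  have As: "A \<in> sets M" using A by (simp add: P_atom_def)
  then show "A \<union> N \<in> sets M" using N by simp
  have "measure M A \<le> measure M (A \<union> N)" using As N by (intro finite_measure_mono) auto
  then show "measure M (A \<union> N) > 0" using A by (simp add: P_atom_def)
  fix S assume S: "S \<in> sets M" "S \<subseteq> A \<union> N"
  have "measure M (S \<inter> A) = 0 \<or> measure M (A - S \<inter> A) = 0"
    using A As S by (auto simp: P_atom_def)
  moreover have "measure M S \<le> measure M (S \<inter> A) + measure M N"
    by (rule order_trans[OF finite_measure_mono[of S "(S \<inter> A) \<union> N"] measure_Un_le])
      (use As S N in auto)
  moreover have "measure M ((A \<union> N) - S) \<le> measure M (A - S \<inter> A) + measure M N"
    by (rule order_trans[OF finite_measure_mono[of _ "(A - S \<inter> A) \<union> N"] measure_Un_le])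
      (use As S N in auto)
  ultimately show "measure M S = 0 \<or> measure M ((A \<union> N) - S) = 0"
    using N(2) measure_nonneg[of M S] measure_nonneg[of M "(A \<union> N) - S"] by linarith
qed

text \<open>Within each atom A, a measurable set S is either null or differs from A by a null set,
  so S \<inter> A lies in the completion. Countably many such pieces make up S.\<close>

lemma (in finite_measure) sets_subset_P_completion:
  assumes "countable \<A>" "\<And>A. A \<in> \<A> \<Longrightarrow> P_atom M A" "\<Union>\<A> = space M"
  shows "sets M \<subseteq> P_completion M (sigma_sets (space M) \<A>)"
proof
  fix S assume S: "S \<in> sets M"
  let ?P = "P_completion M (sigma_sets (space M) \<A>)"
  have \<A>: "A \<in> sets M" if "A \<in> \<A>" for A using assms(2)[OF that] by (simp add: P_atom_def)
  have "\<A> \<subseteq> Pow (space M)" using \<A> sets.sets_into_space by auto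
  from sigma_sets_into_sp[OF this] have "sigma_sets (space M) \<A> \<subseteq> Pow (space M)" by auto
  moreover have "null_sets (completion M) \<subseteq> Pow (space M)"
    using sets.sets_into_space[of _ "completion M"] by (auto simp: null_sets_def)
  ultimately interpret P: sigma_algebra "space M" ?P
    unfolding P_completion_def by (intro sigma_algebra_sigma_sets) auto
  have in_P: "A \<in> ?P" if "A \<in> \<A>" for A
    using that unfolding P_completion_def by (intro sigma_sets.Basic) (auto intro: sigma_sets.Basic)
  have null_P: "T \<in> ?P" if "T \<in> sets M" "measure M T = 0" for T
  proof -
    have "T \<in> null_sets M" using that by (simp add: null_sets_def emeasure_eq_measure)
    then show ?thesis
      unfolding P_completion_def by (auto intro!: sigma_sets.Basic null_sets_completionI)
  qed
  have "S \<inter> A \<in> ?P" if A: "A \<in> \<A>" for A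
  proof -
    have "measure M (S \<inter> A) = 0 \<or> measure M (A - S \<inter> A) = 0"
      using assms(2)[OF A] S \<A>[OF A] by (auto simp: P_atom_def)
    then show ?thesis
    proof
      assume "measure M (S \<inter> A) = 0"
      then show ?thesis using S \<A>[OF A] by (intro null_P) auto
    next
      assume "measure M (A - S \<inter> A) = 0"
      then have "A - S \<inter> A \<in> ?P" using S \<A>[OF A] by (intro null_P) auto
      then have "A - (A - S \<inter> A) \<in> ?P" using in_P[OF A] by (rule P.Diff[rotated])
      moreover have "A - (A - S \<inter> A) = S \<inter> A" by blast
      ultimately show ?thesis by simp
    qed
  qed
  then have "(\<Union>A\<in>\<A>. S \<inter> A) \<in> ?P" using assms(1) by (intro P.countable_UN'') auto
  moreover have "(\<Union>A\<in>\<A>. S \<inter> A) = S" using assms(3) sets.sets_into_space[OF S] by auto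
  ultimately show "S \<in> ?P" by simp
qed

text \<open>Disjointifying the atoms leaves atoms and null sets; the null remainder is absorbed into
  one of the atoms.\<close>

lemma (in prob_space) essentially_purely_atomicI:
  assumes D: "countable D" "\<And>A. A \<in> D \<Longrightarrow> P_atom M A" and null: "prob (space M - \<Union>D) = 0"
  shows "essentially_purely_atomic M"
proof -
  have "D \<noteq> {}" using null prob_space by auto
  \<comment> \<open>The enumeration may repeat sets, for instance when \<open>D\<close> is finite.
    Disjointification turns repetitions into empty sets, which \<open>K\<close> then
    discards.\<close>
  define A where "A = from_nat_into D"
  have rA: "range A = D" unfolding A_def using D(1) \<open>D \<noteq> {}\<close> by (rule range_from_nat_into[rotated])
  have atom: "P_atom M (A n)" for n using D(2) rA by blast
  then have sA: "range A \<subseteq> sets M" by (auto simp: P_atom_def)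
  define B where "B = disjointed A"
  have sB [measurable]: "B n \<in> sets M" for n
    using sets.range_disjointed_sets[OF sA] by (auto simp: B_def)
  have BA: "B n \<subseteq> A n" for n unfolding B_def by (rule disjointed_subset)
  have UB: "(\<Union>n. B n) = \<Union>D" unfolding B_def UN_disjointed_eq rA[symmetric] ..
  define K where "K = {n. prob (B n) > 0}"
  have B_atom: "P_atom M (B n)" if "n \<in> K" for n
    using that by (intro P_atom_subset[OF atom sB BA]) (simp add: K_def)
  define N where "N = space M - (\<Union>n\<in>K. B n)"
  have sN: "N \<in> sets M" by (simp add: N_def)
  have N_sub: "N \<subseteq> (space M - \<Union>D) \<union> (\<Union>n\<in>- K. B n)"
    unfolding UB[symmetric] N_def by blast
  have "AE w in M. w \<notin> space M - \<Union>D"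
  proof (rule AE_not_in)
    have "\<Union>D \<in> sets M" unfolding UB[symmetric] by auto
    then show "space M - \<Union>D \<in> null_sets M" using null by (simp add: null_sets_def emeasure_eq_measure)
  qed
  moreover have "AE w in M. \<forall>n\<in>- K. w \<notin> B n"
  proof (subst AE_ball_countable, simp, intro ballI AE_not_in)
    fix n assume "n \<in> - K"
    then have "prob (B n) = 0" using measure_nonneg[of M "B n"] by (simp add: K_def)
    then show "B n \<in> null_sets M" by (simp add: null_sets_def emeasure_eq_measure)
  qed
  ultimately have "AE w in M. w \<notin> N" by eventually_elim (use N_sub in blast)
  then have N0: "prob N = 0" using prob_eq_0[OF sN] by simp
  \<comment> \<open>The total mass is 1, so at least one atom survives to absorb the null set
    \<open>N\<close>.\<close>
  have "K \<noteq> {}"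
  proof
    assume "K = {}"
    then have "N = space M" by (simp add: N_def)
    then show False using N0 prob_space by simp
  qed
  then obtain n0 where n0: "n0 \<in> K" by blast
  define C where "C n = (if n = n0 then B n \<union> N else B n)" for n
  have C_atom: "P_atom M (C n)" if "n \<in> K" for n
    using B_atom[OF that] P_atom_Un_null[OF B_atom[OF that] sN N0] by (auto simp: C_def)
  have UC: "\<Union>(C ` K) = space M"
  proof -
    have "\<Union>(C ` K) = (\<Union>n\<in>K. B n) \<union> N" using n0 by (auto simp: C_def split: if_splits)
    also have "\<dots> = space M" using sets.sets_into_space[OF sB] by (auto simp: N_def)
    finally show ?thesis .
  qed
  have "disjoint_family_on C K"
    using disjoint_family_disjointed[of A]
    by (fastforce simp: disjoint_family_on_def C_def N_def B_def)
  then have "disjoint (C ` K)" by (rule disjoint_family_on_disjoint_image)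
  then show ?thesis
    unfolding essentially_purely_atomic_def
    using C_atom UC sets_subset_P_completion[of "C ` K"] by (intro exI[of _ "C ` K"]) auto
qed

text \<open>A set that is not an atom splits into two parts of positive measure. Always keeping one
  part gives a decreasing sequence, and the discarded parts are the disjoint sets sought.\<close>

lemma (in finite_measure) atomless_disjoint_sequence:
  assumes B: "B \<in> sets M" "measure M B > 0" and no_atom: "\<And>A. A \<subseteq> B \<Longrightarrow> \<not> P_atom M A"
  obtains C :: "nat \<Rightarrow> 'a set" where "\<And>n. C n \<in> sets M" "\<And>n. C n \<subseteq> B" "\<And>n. measure M (C n) > 0"
    "disjoint_family C"
proof -
  define Q where "Q S \<longleftrightarrow> S \<in> sets M \<and> S \<subseteq> B \<and> measure M S > 0" for S
  have "\<exists>T. Q T \<and> T \<subseteq> S \<and> measure M (S - T) > 0" if "Q S" for S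
  proof -
    have "\<not> P_atom M S" "S \<in> sets M" "measure M S > 0" using that no_atom by (simp_all add: Q_def)
    then obtain T where "T \<in> sets M" "T \<subseteq> S" "measure M T \<noteq> 0" "measure M (S - T) \<noteq> 0"
      unfolding P_atom_def by blast
    then show ?thesis using that by (intro exI[of _ T]) (auto simp: Q_def zero_less_measure_iff)
  qed
  moreover have "Q B" using B by (simp add: Q_def)
  ultimately obtain S where S: "\<And>n. Q (S n)" "\<And>n. S (Suc n) \<subseteq> S n \<and> measure M (S n - S (Suc n)) > 0"
    using dependent_nat_choice[of "\<lambda>_. Q" "\<lambda>_ S T. T \<subseteq> S \<and> measure M (S - T) > 0"] by metis
  have "decseq S" using S(2) by (intro decseq_SucI) blast
  show thesis
  proof (rule that)
    show "S n - S (Suc n) \<in> sets M" "S n - S (Suc n) \<subseteq> B" "measure M (S n - S (Suc n)) > 0" for n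
      using S(1)[of n] S(1)[of "Suc n"] S(2)[of n] by (auto simp: Q_def)
    have "(S m - S (Suc m)) \<inter> (S n - S (Suc n)) = {}" if "m < n" for m n
      using decseqD[OF \<open>decseq S\<close>, of "Suc m" n] that by auto
    then show "disjoint_family (\<lambda>n. S n - S (Suc n))"
      unfolding disjoint_family_on_def by (metis Int_commute linorder_neqE_nat)
  qed
qed

section \<open>Compactness of the dual ball forces atomicity\<close>

context rn_module
begin

lemma full_support_nonzero:
  assumes full: "full_support M E nrm" and A: "A \<in> sets M" "prob A > 0"
  obtains x where "x \<in> carrier E" "prob {w \<in> A. N x w \<noteq> 0} > 0"
proof (rule ccontr)
  note witness = that
  assume "\<not> thesis"
  then have no: "\<not> prob {w \<in> A. N x w \<noteq> 0} > 0" if "x \<in> carrier E" for x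
    using witness that by blast
  let ?L = "L0_ereal_lattice M" and ?X = "(\<lambda>x. L0_ereal M (nrm x)) ` carrier E"
  have meas: "(\<lambda>w. ereal (N x w)) \<in> borel_measurable M" if "x \<in> carrier E" for x
    using N_measurable[OF that] by simp
  have X: "?X \<subseteq> L0 M" using meas by (auto simp: L0_ereal_def N_def intro!: L0_class_in)
  \<comment> \<open>If all norms vanished a.e. on \<open>A\<close>, this function would be an upper
    bound of them, so their supremum would be at most 0 on \<open>A\<close>, against full
    support.\<close>
  define u where "u w = (if w \<in> A then 0 else \<infinity> :: ereal)" for w
  have u_meas: "u \<in> borel_measurable M" using A(1) unfolding u_def by measurable
  note u_rep = L0_rep_class(2)[OF u_meas]
  have "L0_le M (L0_ereal M (nrm x)) (L0_class M u)" if x: "x \<in> carrier E" for x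
  proof -
    have [measurable]: "N x \<in> borel_measurable M" by (rule N_measurable[OF x])
    have s: "{w \<in> A. N x w \<noteq> 0} \<in> sets M"
    proof -
      have "A \<inter> {w \<in> space M. N x w \<noteq> 0} \<in> sets M" using A(1) by measurable
      moreover have "A \<inter> {w \<in> space M. N x w \<noteq> 0} = {w \<in> A. N x w \<noteq> 0}"
        using sets.sets_into_space[OF A(1)] by auto
      ultimately show ?thesis by simp
    qed
    have "prob {w \<in> A. N x w \<noteq> 0} = 0" using no[OF x] by (simp add: zero_less_measure_iff)
    then have "AE w in M. w \<notin> {w \<in> A. N x w \<noteq> 0}" using prob_eq_0[OF s] by simp
    with u_rep L0_rep_class(2)[OF meas[OF x]] show ?thesis
      unfolding L0_le_def L0_ereal_def N_def[symmetric] by eventually_elim (auto simp: u_def)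
  qed
  then have "L0_class M u \<in> Upper ?L ?X"
    using L0_class_in[OF u_meas] by (auto simp: Upper_def L0_ereal_lattice_def)
  then have "L0_le M (\<Squnion>\<^bsub>?L\<^esub> ?X) (L0_class M u)"
    using least_L0_sup[OF finite_measure_axioms X] by (auto simp: least_def L0_ereal_lattice_def)
  with full u_rep have "AE w in M. w \<notin> A"
    unfolding full_support_def L0_le_def by eventually_elim (auto simp: u_def)
  then show False using prob_eq_0[OF A(1)] A(2) by simp
qed

lemma compact_imp_essentially_purely_atomic:
  assumes norming and full: "full_support M E nrm"
    and comp: "compactin (sigma_c M E nrm) (dual_unit_ball M E nrm)"
  shows "essentially_purely_atomic M"
proof (rule ccontr)
  assume not_atomic: "\<not> essentially_purely_atomic M"
  have "{A. P_atom M A} \<subseteq> sets M" by (auto simp: P_atom_def)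
  from countable_exhaustion[OF this] obtain D where D: "D \<subseteq> {A. P_atom M A}" "countable D"
    "\<forall>S\<in>{A. P_atom M A}. prob (S - \<Union>D) = 0" by auto
  define A where "A = space M - \<Union>D"
  have "\<Union>D \<in> sets M" using D(1,2) by (intro sets.countable_Union) (auto simp: P_atom_def)
  then have A: "A \<in> sets M" by (simp add: A_def)
  have "prob A \<noteq> 0" using not_atomic essentially_purely_atomicI[OF D(2)] D(1) by (auto simp: A_def)
  then have "prob A > 0" by (simp add: zero_less_measure_iff)
  then obtain x where x: "x \<in> carrier E" and pos: "prob {w \<in> A. N x w \<noteq> 0} > 0"
    by (rule full_support_nonzero[OF full A])
  define B where "B = {w \<in> A. N x w \<noteq> 0}"
  have "prob B > 0" using pos by (simp add: B_def)
  \<comment> \<open>A non-measurable set has \<open>measure\<close> 0 by convention, so positive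
    probability already implies measurability.\<close>
  moreover from this have "B \<in> sets M" using measure_notin_sets[of B M] by fastforce
  ultimately have B: "B \<in> sets M" "prob B > 0" by auto
  \<comment> \<open>An atom inside \<open>B\<close> is disjoint from the exhausting atoms, so by
    their exhaustion property it would be null.\<close>
  have "\<not> P_atom M S" if "S \<subseteq> B" for S
  proof
    assume S: "P_atom M S"
    have "S - \<Union>D = S" using that by (auto simp: B_def A_def)
    then show False using D(3) S by (auto simp: P_atom_def)
  qed
  then obtain C :: "nat \<Rightarrow> 'w set" where C: "\<And>n. C n \<in> sets M" "\<And>n. C n \<subseteq> B" "\<And>n. prob (C n) > 0"
    "disjoint_family C"
    using atomless_disjoint_sequence[OF B] by blast
  obtain f where f: "contraction f" "AE w in M. N x w \<noteq> 0 \<longrightarrow> f x w \<noteq> 0"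
    using \<open>norming\<close> x by (auto simp: norming_def)
  have "AE w in M. w \<in> C n \<longrightarrow> f x w \<noteq> 0" for n
    using f(2) by eventually_elim (use C(2)[of n] in \<open>auto simp: B_def\<close>)
  from dual_unit_ball_not_compact[OF x f(1) C(1,3,4) this] comp show False by blast
qed

end

section \<open>The module of all random variables over an infinite atomic space\<close>

definition L0_module :: "'w measure \<Rightarrow> (('w \<Rightarrow> 'k::real_normed_field) set, ('w \<Rightarrow> 'k) set) module" where
  "L0_module M = ring.extend (L0_ring M) (module.fields (monoid.mult (L0_ring M)))"

lemma L0_module_simps [simp]:
  "carrier (L0_module M) = L0 M" "add (L0_module M) = add (L0_ring M)"
  "ring.zero (L0_module M) = ring.zero (L0_ring M)" "smult (L0_module M) = monoid.mult (L0_ring M)"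
  by (simp_all add: L0_module_def L0_ring_def ring.defs module.defs)

lemma rn_module_L0_module:
  fixes M :: "'w measure"
  assumes "prob_space M"
  shows "rn_module M (L0_module M :: (('w \<Rightarrow> 'k::{real_normed_field, second_countable_topology}) set, ('w \<Rightarrow> 'k) set) module)
    (L0_abs M)"
proof -
  let ?R = "L0_ring M :: ('w \<Rightarrow> 'k) set ring" and ?E = "L0_module M :: (('w \<Rightarrow> 'k) set, ('w \<Rightarrow> 'k) set) module"
  interpret prob_space M by fact
  interpret R: cring ?R by (rule cring_L0_ring)
  interpret S: cring "L0_ring M :: ('w \<Rightarrow> real) set ring" by (rule cring_L0_ring)
  note [simp del] = L0_module_simps(1)
  have car: "carrier ?E = carrier ?R" by (simp add: carrier_L0_ring L0_module_simps)
  have "abelian_group ?E"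
  proof (rule abelian_groupI, unfold car L0_module_simps(2,3))
    fix x assume "x \<in> carrier ?R"
    then show "\<exists>y\<in>carrier ?R. y \<oplus>\<^bsub>?R\<^esub> x = \<zero>\<^bsub>?R\<^esub>" using R.l_neg R.a_inv_closed by blast
  qed (simp_all add: R.a_ac)
  then have mod: "Module.module ?R ?E"
    by (intro moduleI R.is_cring) (auto simp: car R.l_distr R.r_distr R.m_assoc)
  have car': "carrier ?E = L0 M" by (simp add: L0_module_simps)
  have zero: "\<zero>\<^bsub>?R\<^esub> \<in> L0 M" "\<zero>\<^bsub>L0_ring M :: ('w \<Rightarrow> real) set ring\<^esub> \<in> L0 M"
    using R.zero_closed S.zero_closed by (simp_all add: carrier_L0_ring)
  note closed = R.add.m_closed[unfolded carrier_L0_ring] R.m_closed[unfolded carrier_L0_ring]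
    S.add.m_closed[unfolded carrier_L0_ring] S.m_closed[unfolded carrier_L0_ring]
  have "random_normed_module_axioms M ?E (L0_abs M)"
  proof
    fix x assume "x \<in> carrier ?E"
    then have x: "x \<in> L0 M" by (simp add: car')
    have "AE w in M. L0_rep (L0_class M (\<lambda>w. 0)) w = (0::real)" by (rule L0_rep_class(2)) simp
    with L0_rep_abs[OF x] have "L0_le M (L0_class M (\<lambda>w. 0)) (L0_abs M x)"
      unfolding L0_le_def by eventually_elim simp
    then show "L0_abs M x \<in> L0_plus M" using L0_abs_in[OF x] by (simp add: L0_plus_def)
    show "L0_abs M x = \<zero>\<^bsub>L0_ring M\<^esub> \<longleftrightarrow> x = \<zero>\<^bsub>?E\<^esub>"
    proof
      assume "L0_abs M x = \<zero>\<^bsub>L0_ring M\<^esub>"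
      then have "AE w in M. L0_rep (L0_abs M x) w = 0" using L0_rep_zero[of M] by simp
      with L0_rep_abs[OF x] L0_rep_zero[of M] have "AE w in M. L0_rep x w = L0_rep \<zero>\<^bsub>?R\<^esub> w"
        by eventually_elim simp
      then show "x = \<zero>\<^bsub>?E\<^esub>" using L0_eqI[OF x zero(1)] by simp
    next
      assume "x = \<zero>\<^bsub>?E\<^esub>"
      then have "AE w in M. L0_rep x w = 0" using L0_rep_zero[of M] by simp
      with L0_rep_abs[OF x] L0_rep_zero[of M]
      have "AE w in M. L0_rep (L0_abs M x) w = L0_rep \<zero>\<^bsub>L0_ring M\<^esub> w"
        by eventually_elim simp
      then show "L0_abs M x = \<zero>\<^bsub>L0_ring M\<^esub>" by (rule L0_eqI[OF L0_abs_in[OF x] zero(2)])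
    qed
    fix y assume "y \<in> carrier ?E"
    then have y: "y \<in> L0 M" by (simp add: car')
    show "L0_le M (L0_abs M (x \<oplus>\<^bsub>?E\<^esub> y)) (L0_abs M x \<oplus>\<^bsub>L0_ring M\<^esub> L0_abs M y)"
      using L0_rep_add[OF x y] L0_rep_abs[OF closed(1)[OF x y]] L0_rep_abs[OF x] L0_rep_abs[OF y]
        L0_rep_add[OF L0_abs_in[OF x] L0_abs_in[OF y]]
      unfolding L0_le_def L0_module_simps by eventually_elim (simp add: norm_triangle_ineq)
  next
    fix \<xi> :: "('w \<Rightarrow> 'k) set" and x assume \<xi>: "\<xi> \<in> L0 M" and "x \<in> carrier ?E"
    then have x: "x \<in> L0 M" by (simp add: car')
    have "AE w in M. L0_rep (L0_abs M (\<xi> \<otimes>\<^bsub>?R\<^esub> x)) w = L0_rep (L0_abs M \<xi> \<otimes>\<^bsub>L0_ring M\<^esub> L0_abs M x) w"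
      using L0_rep_mult[OF \<xi> x] L0_rep_abs[OF closed(2)[OF \<xi> x]] L0_rep_abs[OF x] L0_rep_abs[OF \<xi>]
        L0_rep_mult[OF L0_abs_in[OF \<xi>] L0_abs_in[OF x]]
      by eventually_elim (simp add: norm_mult)
    then show "L0_abs M (\<xi> \<odot>\<^bsub>?E\<^esub> x) = L0_abs M \<xi> \<otimes>\<^bsub>L0_ring M\<^esub> L0_abs M x"
      unfolding L0_module_simps
      by (rule L0_eqI[OF L0_abs_in[OF closed(2)[OF \<xi> x]] closed(4)[OF L0_abs_in[OF \<xi>] L0_abs_in[OF x]]])
  qed
  then show ?thesis
    by (intro rn_module.intro random_normed_module.intro mod prob_space_axioms)
qed

section \<open>Counterexample over the geometric distribution\<close>

context
  fixes M :: "nat measure"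
  assumes M: "M = measure_pmf (geometric_pmf (1 / 2))"
begin

text \<open>The parameter 1/2 gives every natural number positive mass, so the singletons are
  infinitely many disjoint atoms covering the space.\<close>

lemma geometric_singleton: "{n} \<in> sets M" "measure M {n} > 0"
  by (simp_all add: M measure_pmf_single)

lemma geometric_atomic: "essentially_purely_atomic M"
proof -
  interpret prob_space M unfolding M by (rule prob_space_measure_pmf)
  show ?thesis
  proof (rule essentially_purely_atomicI[of "range (\<lambda>n. {n})"])
    show "P_atom M A" if "A \<in> range (\<lambda>n. {n})" for A
      using that geometric_singleton by (auto simp: P_atom_def subset_singleton_iff)
    have "\<Union>(range (\<lambda>n::nat. {n})) = UNIV" by auto
    then show "prob (space M - \<Union>(range (\<lambda>n. {n}))) = 0" by simp
  qed simp
qed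

lemma L0_module_not_compact:
  fixes E :: "((nat \<Rightarrow> 'k::{real_normed_field, second_countable_topology}) set, (nat \<Rightarrow> 'k) set) module"
  assumes E: "E = L0_module M"
  shows "rn_module M E (L0_abs M)" "full_support M E (L0_abs M)"
    and "rn_module.norming M E (L0_abs M) \<Longrightarrow>
      \<not> compactin (sigma_c M E (L0_abs M)) (dual_unit_ball M E (L0_abs M))"
proof -
  interpret prob_space M unfolding M by (rule prob_space_measure_pmf)
  show rn: "rn_module M E (L0_abs M)" unfolding E by (rule rn_module_L0_module[OF prob_space_axioms])
  interpret rn_module M E "L0_abs M" by (rule rn)
  define x where "x = L0_class M (\<lambda>w. 1 :: 'k)"
  have x: "x \<in> carrier E" by (simp add: E x_def L0_class_in)
  have x': "x \<in> L0 M" by (simp add: x_def L0_class_in)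
  have "AE w in M. L0_rep x w = 1" unfolding x_def by (rule L0_rep_class(2)) simp
  with L0_rep_abs[OF x'] have Nx: "AE w in M. N x w = 1"
    unfolding N_def by eventually_elim simp
  let ?X = "(\<lambda>x. L0_ereal M (L0_abs M x)) ` carrier E"
  have meas: "(\<lambda>w. ereal (N y w)) \<in> borel_measurable M" if "y \<in> carrier E" for y
    using N_measurable[OF that] by simp
  have X: "?X \<subseteq> L0 M" using meas by (auto simp: L0_ereal_def N_def intro!: L0_class_in)
  \<comment> \<open>The constant 1 has norm 1, so the supremum of all norms is a.e. at least
    1.\<close>
  have "L0_le M (L0_ereal M (L0_abs M x)) (\<Squnion>\<^bsub>L0_ereal_lattice M\<^esub> ?X)"
    using least_L0_sup[OF finite_measure_axioms X] x X by (auto simp: least_def Upper_def L0_ereal_lattice_def)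
  with L0_rep_class(2)[OF meas[OF x]] Nx show "full_support M E (L0_abs M)"
    unfolding full_support_def L0_le_def L0_ereal_def N_def[symmetric]
  proof eventually_elim
    case (elim w)
    then have "ereal 1 \<le> L0_rep (\<Squnion>\<^bsub>L0_ereal_lattice M\<^esub> (\<lambda>y. L0_class M (\<lambda>w. ereal (N y w))) ` carrier E) w"
      by simp
    then show ?case by (rule less_le_trans[rotated]) simp
  qed
  assume norming
  then obtain f where f: "contraction f" "AE w in M. N x w \<noteq> 0 \<longrightarrow> f x w \<noteq> 0"
    using x by (auto simp: norming_def)
  have "AE w in M. w \<in> {n} \<longrightarrow> f x w \<noteq> 0" for n
    using f(2) Nx by eventually_elim auto
  then show "\<not> compactin (sigma_c M E (L0_abs M)) (dual_unit_ball M E (L0_abs M))"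
    by (intro dual_unit_ball_not_compact[OF x f(1), of "\<lambda>n. {n}"] geometric_singleton)
      (auto simp: disjoint_family_on_def)
qed

end

text \<open>The scalar field is a type here, so each half appears once for \<open>real\<close> and
  once for \<open>complex\<close>; in particular the converse fails over both fields.\<close>

theorem theorem4p16:
  shows
  "(\<forall>(M :: 'w measure) (E :: (('w \<Rightarrow> real) set, 'e) module) nrm.
      random_normed_module M E nrm \<and> full_support M E nrm \<and>
      compactin (sigma_c M E nrm) (dual_unit_ball M E nrm)
      \<longrightarrow> essentially_purely_atomic M) \<and>
   (\<forall>(M :: 'w measure) (E :: (('w \<Rightarrow> complex) set, 'e) module) nrm.
      random_normed_module M E nrm \<and> full_support M E nrm \<and>
      compactin (sigma_c M E nrm) (dual_unit_ball M E nrm)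
      \<longrightarrow> essentially_purely_atomic M) \<and>
   (\<exists>(M :: nat measure) (E :: ((nat \<Rightarrow> real) set, (nat \<Rightarrow> real) set) module) nrm.
      essentially_purely_atomic M \<and> random_normed_module M E nrm \<and> full_support M E nrm \<and>
      \<not> compactin (sigma_c M E nrm) (dual_unit_ball M E nrm)) \<and>
   (\<exists>(M :: nat measure) (E :: ((nat \<Rightarrow> complex) set, (nat \<Rightarrow> complex) set) module) nrm.
      essentially_purely_atomic M \<and> random_normed_module M E nrm \<and> full_support M E nrm \<and>
      \<not> compactin (sigma_c M E nrm) (dual_unit_ball M E nrm))"
proof (intro conjI allI impI)
  fix M :: "'w measure" and E :: "(('w \<Rightarrow> real) set, 'e) module" and nrm
  assume *: "random_normed_module M E nrm \<and> full_support M E nrm \<and>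
      compactin (sigma_c M E nrm) (dual_unit_ball M E nrm)"
  then have rn: "rn_module M E nrm" by (intro rn_module.intro) simp
  show "essentially_purely_atomic M"
    using rn_module.compact_imp_essentially_purely_atomic[OF rn norming_real[OF rn]] * by blast
next
  fix M :: "'w measure" and E :: "(('w \<Rightarrow> complex) set, 'e) module" and nrm
  assume *: "random_normed_module M E nrm \<and> full_support M E nrm \<and>
      compactin (sigma_c M E nrm) (dual_unit_ball M E nrm)"
  then have rn: "rn_module M E nrm" by (intro rn_module.intro) simp
  show "essentially_purely_atomic M"
    using rn_module.compact_imp_essentially_purely_atomic[OF rn norming_complex[OF rn]] * by blast
next
  note E = L0_module_not_compact[OF refl refl, where 'k = real]
  show "\<exists>(M :: nat measure) (E :: ((nat \<Rightarrow> real) set, (nat \<Rightarrow> real) set) module) nrm.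
      essentially_purely_atomic M \<and> random_normed_module M E nrm \<and> full_support M E nrm \<and>
      \<not> compactin (sigma_c M E nrm) (dual_unit_ball M E nrm)"
    by (intro exI conjI) (rule geometric_atomic[OF refl] rn_module.axioms[OF E(1)] E(2)
      E(3)[OF norming_real[OF E(1)]])+
next
  note E = L0_module_not_compact[OF refl refl, where 'k = complex]
  show "\<exists>(M :: nat measure) (E :: ((nat \<Rightarrow> complex) set, (nat \<Rightarrow> complex) set) module) nrm.
      essentially_purely_atomic M \<and> random_normed_module M E nrm \<and> full_support M E nrm \<and>
      \<not> compactin (sigma_c M E nrm) (dual_unit_ball M E nrm)"
    by (intro exI conjI) (rule geometric_atomic[OF refl] rn_module.axioms[OF E(1)] E(2)
      E(3)[OF norming_complex[OF E(1)]])+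
qed

end
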